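(* Let $0<d<\pi/2$, $\mathscr{D}_d=\{\zeta\in\mathbb{C}:|\Im\zeta|<d\}$, $\mathscr{D}_d^{-}=\{\zeta\in\mathscr{D}_d:\Re\zeta<0\}$, $\mathscr{D}_d^{+}=\{\zeta\in\mathscr{D}_d:\Re\zeta\ge0\}$, and $\psi(t)=\sinh[(\pi/2)\sinh t]$. Assume $f$ is analytic on $\psi(\mathscr{D}_d)$ and there are constants $K,\alpha,\beta>0$ such that $|f(z)|\le K|1+z^2|^{-(\alpha+1)/2}$ for all $z\in\psi(\mathscr{D}_d^{-})$ and $|f(z)|\le K|1+z^2|^{-(\beta+1)/2}$ for all $z\in\psi(\mathscr{D}_d^{+})$. Let $\mu=\min\{\alpha,\beta\}$, $\nu=\max\{\alpha,\beta\}$, let $n$ be a positive integer, $h=\log(8dn/\mu)/n$, and let $M=n$, $N=n-\lfloor\log(\beta/\alpha)/h\rfloor$ if $\mu=\alpha$, and $N=n$, $M=n-\lfloor\log(\alpha/\beta)/h\rfloor$ if $\mu=\beta$. Suppose $n\ge \nu e/(8d)$, $Mh\ge x_{\alpha/2}$ and $Nh\ge x_{\beta/2}$. Then \[ \left|\int_{-\infty}^{\infty}f(t)\,dt-h\sum_{k=-M}^{N}f(\psi(kh))\psi'(kh)\right|\le C_1e^{-2\pi dn/\log(8dn/\mu)}, \] with $C_1=\frac{2^{\nu+1}K}{\mu}\left\{\frac{2}{(1-e^{-\pi\mu e/4})\{\cos(\frac{\pi}{2}\sin d)\}^{\nu}\cos d}+e^{\pi\nu/4}\right\}$.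
   Context: For $\gamma>0$, $x_\gamma=\operatorname{arcsinh}\!\left(\frac{\sqrt{1+\sqrt{1-(2\pi\gamma)^2}}}{2\pi\gamma}\right)$ if $0<\gamma<1/(2\pi)$, and $x_\gamma=\operatorname{arcsinh}(1)$ if $\gamma\ge 1/(2\pi)$. $\psi(\cdot)$ of a set denotes its image. *)

theory Defs
  imports "HOL-Analysis.Analysis"
begin

definition psi :: "complex \<Rightarrow> complex" where
  "psi t = sinh (complex_of_real (pi/2) * sinh t)"

definition strip :: "real \<Rightarrow> complex set" where
  "strip d = {z. \<bar>Im z\<bar> < d}"

definition strip_minus :: "real \<Rightarrow> complex set" where
  "strip_minus d = {z \<in> strip d. Re z < 0}"

definition strip_plus :: "real \<Rightarrow> complex set" where
  "strip_plus d = {z \<in> strip d. Re z \<ge> 0}"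

definition xg :: "real \<Rightarrow> real" where
  "xg \<gamma> = (if \<gamma> < 1/(2*pi)
     then arsinh (sqrt (1 + sqrt (1 - (2*pi*\<gamma>)^2)) / (2*pi*\<gamma>))
     else arsinh 1)"

end

theory Submission
  imports Defs "HOL-Complex_Analysis.Complex_Analysis" "HOL-Real_Asymp.Real_Asymp"
begin

text \<open>
  Substituting \<open>t = psi x\<close> turns the integral into that of \<open>g = (f \<circ> psi) * psi'\<close>, which is
  holomorphic on the strip. Integrating \<open>g z / (1 - exp (- 2 * pi * \<i> * z / h))\<close> around a rectangle
  of height \<open>2 * y\<close>, whose residues are the trapezoidal terms, bounds the discretization error by
  \<open>1 / (exp (2 * pi * y / h) - 1)\<close> times the integrals of \<open>norm g\<close> over the lines \<open>Im z = \<plusminus>y\<close>; then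
  \<open>y\<close> tends to \<open>d\<close>. The estimate
  \<open>norm (cosh (pi / 2 * sinh (x + \<i> * y))) \<ge> cosh (pi / 2 * sinh x * cos y) * cos (pi / 2 * sin y)\<close>
  reduces those integrals, as well as the truncation error, to the weight
  \<open>a * cosh x * exp (- a * sinh x)\<close>, which has an elementary antiderivative.
\<close>

section \<open>Lower bound for the hyperbolic cosine in the strip\<close>

lemma sinh_le_mult_cosh:
  fixes x :: real
  assumes "0 \<le> x"
  shows "sinh x \<le> x * cosh x"
proof -
  have "0 * cosh 0 - sinh 0 \<le> x * cosh x - sinh x"
  proof (rule DERIV_nonneg_imp_nondecreasing [OF assms])
    fix t :: real assume "0 \<le> t" "t \<le> x"
    then show "\<exists>y. ((\<lambda>x. x * cosh x - sinh x) has_real_derivative y) (at t) \<and> 0 \<le> y"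
      by (intro exI[of _ "t * sinh t"]) (auto intro!: derivative_eq_intros)
  qed
  then show ?thesis by simp
qed

lemma divide_le_tanh:
  fixes x :: real
  assumes "0 \<le> x"
  shows "x / (1 + x\<^sup>2 / 3) \<le> tanh x"
proof -
  define F :: "real \<Rightarrow> real" where "F = (\<lambda>x. (1 + x\<^sup>2 / 3) * sinh x - x * cosh x)"
  have "F 0 \<le> F x"
  proof (rule DERIV_nonneg_imp_nondecreasing [OF assms])
    fix t :: real assume "0 \<le> t" "t \<le> x"
    have "(F has_real_derivative t / 3 * (t * cosh t - sinh t)) (at t)"
      unfolding F_def by (auto intro!: derivative_eq_intros simp: field_simps power2_eq_square)
    moreover have "0 \<le> t / 3 * (t * cosh t - sinh t)"
      using sinh_le_mult_cosh \<open>0 \<le> t\<close> by simp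
    ultimately show "\<exists>y. (F has_real_derivative y) (at t) \<and> 0 \<le> y" by blast
  qed
  then have "x * cosh x \<le> (1 + x\<^sup>2 / 3) * sinh x" by (simp add: F_def)
  moreover have "0 < 1 + x\<^sup>2 / 3" by (intro add_pos_nonneg) auto
  ultimately show ?thesis by (simp add: tanh_def field_simps)
qed

lemma divide_le_tan_half_pi:
  fixes s :: real
  assumes "0 \<le> s" "s < 1"
  shows "2 / pi * (s / (1 - s\<^sup>2)) \<le> tan (pi / 2 * s)"
proof (cases "s \<le> 1 / 2")
  case True
  have "s\<^sup>2 \<le> (1 / 2)\<^sup>2" using True assms by (intro power_mono) auto
  then have "1 / (1 - s\<^sup>2) \<le> 4 / 3" by (simp add: field_simps)
  also have "\<dots> \<le> (pi / 2)\<^sup>2"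
    using power_mono[of 3 pi 2] pi_gt3 by (simp add: power_divide)
  finally have "2 / pi * s * (1 / (1 - s\<^sup>2)) \<le> 2 / pi * s * (pi / 2)\<^sup>2"
    using assms by (intro mult_left_mono) auto
  then have "2 / pi * (s / (1 - s\<^sup>2)) \<le> pi / 2 * s" by (simp add: power2_eq_square)
  also have "\<dots> \<le> tan (pi / 2 * s)"
    using abs_tan_ge[of "pi / 2 * s"] tan_pos_pi2_le[of "pi / 2 * s"] assms by (simp add: abs_mult)
  finally show ?thesis .
next
  case False
  define u where "u = pi / 2 * (1 - s)"
  have u: "0 < u" "u < pi / 4" using assms False by (auto simp: u_def)
  have "pi / 2 * s = pi / 2 - u" by (simp add: u_def field_simps)
  then have tan_eq: "tan (pi / 2 * s) = cos u / sin u" by (simp only: tan_cot) (simp add: tan_def)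
  have "2 / pi * (s / (1 - s\<^sup>2)) = s / (1 + s) / u"
  proof -
    have "1 - s\<^sup>2 = (1 - s) * (1 + s)" by (simp add: power2_eq_square algebra_simps)
    then show ?thesis by (simp add: u_def mult_ac)
  qed
  also have "\<dots> \<le> cos u / sin u"
  proof (rule frac_le)
    have "s / (1 + s) \<le> 1 / 2" using assms by (simp add: field_simps)
    also have "\<dots> \<le> cos u"
      using u cos_monotone_0_pi_le[of u "pi / 3"] by (simp add: cos_60)
    finally show "s / (1 + s) \<le> cos u" .
    show "0 \<le> cos u" using u by (intro cos_ge_zero) auto
    show "0 < sin u" using u by (intro sin_gt_zero) auto
    show "sin u \<le> u" using u by (intro sin_x_le_x) auto
  qed
  finally show ?thesis by (simp only: tan_eq)
qed

lemma pi_sq_le_12: "pi\<^sup>2 \<le> 12"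
proof -
  have "pi\<^sup>2 \<le> 3.2\<^sup>2" using pi_approx by (intro power_mono) auto
  then show ?thesis by (simp add: power2_eq_square)
qed

lemma one_minus_cosh_sin_sq_mult_le:
  fixes x y :: real
  assumes "\<bar>cosh x * sin y\<bar> \<le> 1"
  shows "(1 + (pi / 2 * (sinh x * cos y))\<^sup>2 / 3) * (1 - (cosh x * sin y)\<^sup>2) \<le> (cosh x * cos y)\<^sup>2"
proof -
  define r where "r = sinh x * cos y"
  define s where "s = cosh x * sin y"
  have s: "0 \<le> 1 - s\<^sup>2" using assms by (simp add: s_def abs_square_le_1)
  have "1 - s\<^sup>2 = (cos y)\<^sup>2 - (sinh x * sin y)\<^sup>2"
    by (simp add: s_def power_mult_distrib sinh_square_eq cos_squared_eq algebra_simps)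
  then have s_le: "1 - s\<^sup>2 \<le> (cos y)\<^sup>2" by simp
  have "(pi / 2 * r)\<^sup>2 / 3 = pi\<^sup>2 / 12 * r\<^sup>2" by (simp add: power_mult_distrib power_divide)
  also have "\<dots> \<le> 1 * r\<^sup>2" using pi_sq_le_12 by (intro mult_right_mono) auto
  finally have "(1 + (pi / 2 * r)\<^sup>2 / 3) * (1 - s\<^sup>2) \<le> (1 + r\<^sup>2) * (1 - s\<^sup>2)"
    using s by (intro mult_right_mono) auto
  also have "\<dots> = (1 - s\<^sup>2) + r\<^sup>2 * (1 - s\<^sup>2)" by (simp add: algebra_simps)
  also have "\<dots> \<le> (cos y)\<^sup>2 + r\<^sup>2 * 1"
    using s_le by (intro add_mono mult_left_mono) auto
  also have "\<dots> = (cosh x * cos y)\<^sup>2"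
    by (simp add: r_def power_mult_distrib cosh_square_eq algebra_simps)
  finally show ?thesis by (simp only: r_def s_def)
qed

lemma tanh_mult_tan_le:
  fixes x y :: real
  assumes x: "0 \<le> x" and y: "0 \<le> y" "y < pi / 2" and less_one: "cosh x * sin y < 1"
  shows "tanh x * tan y \<le> tanh (pi / 2 * (sinh x * cos y)) * tan (pi / 2 * (cosh x * sin y))"
proof -
  define r where "r = sinh x * cos y"
  define s where "s = cosh x * sin y"
  define a where "a = pi / 2 * r"
  have cosy: "0 < cos y" and siny: "0 \<le> sin y"
    using y by (auto intro: cos_gt_zero_pi sin_ge_zero)
  have r: "0 \<le> r" and s: "0 \<le> s" "s < 1"
    using x cosy siny less_one by (auto simp: r_def s_def)
  have pos: "0 < 1 + a\<^sup>2 / 3" "0 < 1 - s\<^sup>2"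
    using s by (auto intro!: add_pos_nonneg simp: power_less_one_iff)
  have denominator_le: "(1 + a\<^sup>2 / 3) * (1 - s\<^sup>2) \<le> (cosh x * cos y)\<^sup>2"
    using one_minus_cosh_sin_sq_mult_le[of x y] s by (simp add: a_def r_def s_def)
  have "tanh x * tan y = r * s / (cosh x * cos y)\<^sup>2"
    using cosy by (simp add: tanh_def tan_def r_def s_def power2_eq_square)
  also have "\<dots> \<le> r * s / ((1 + a\<^sup>2 / 3) * (1 - s\<^sup>2))"
    using denominator_le pos r s
    by (intro divide_left_mono mult_pos_pos mult_nonneg_nonneg) (use cosy in auto)
  also have "\<dots> = a / (1 + a\<^sup>2 / 3) * (2 / pi * (s / (1 - s\<^sup>2)))"
  proof -
    have "r = 2 / pi * a" by (simp add: a_def)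
    then show ?thesis by (simp add: mult_ac)
  qed
  also have "\<dots> \<le> tanh a * tan (pi / 2 * s)"
    using r s pos
    by (intro mult_mono divide_le_tanh divide_le_tan_half_pi) (auto simp: a_def)
  finally show ?thesis by (simp only: a_def r_def s_def)
qed

lemma sin_half_pi_cosh_le:
  fixes x y :: real
  assumes x: "0 \<le> x" and y: "0 \<le> y" "y < pi / 2" and le_one: "cosh x * sin y \<le> 1"
  shows "sin (pi / 2 * (cosh x * sin y)) \<le> cosh (pi / 2 * (sinh x * cos y)) * sin (pi / 2 * sin y)"
proof -
  define a where "a = (\<lambda>t. pi / 2 * (sinh t * cos y))"
  define b where "b = (\<lambda>t. pi / 2 * (cosh t * sin y))"
  define F where "F = (\<lambda>t. sin (b t) / cosh (a t))"
  have cosy: "0 < cos y" and siny: "0 \<le> sin y" "sin y < 1"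
    using y sin_monotone_2pi[of y "pi / 2"] by (auto intro: cos_gt_zero_pi sin_ge_zero)
  have "F x \<le> F 0"
  proof (rule DERIV_nonpos_imp_decreasing_open [OF x])
    fix t assume t: "0 < t" "t < x"
    have "cosh t * sin y < 1"
    proof (cases "sin y = 0")
      case False
      then have "cosh t * sin y < cosh x * sin y"
        using t siny by (simp add: cosh_real_nonneg_less_iff)
      then show ?thesis using le_one by simp
    qed simp
    then have "0 < cos (b t)"
      unfolding b_def using siny by (intro cos_gt_zero_pi) (auto intro: less_le_trans[of _ 0])
    define D where "D = pi / 2 * (cosh t * cos y * cos (b t) * cosh (a t)) / (cosh (a t))\<^sup>2
        * (tanh t * tan y - tanh (a t) * tan (b t))"
    have "(F has_real_derivative D) (at t)"
      unfolding F_def a_def b_def D_def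
      using cosy \<open>0 < cos (b t)\<close> unfolding b_def
      by (auto intro!: derivative_eq_intros simp: tanh_def tan_def field_simps power2_eq_square)
    moreover have "D \<le> 0"
      using tanh_mult_tan_le[of t y] t y \<open>cosh t * sin y < 1\<close> cosy \<open>0 < cos (b t)\<close>
      unfolding D_def by (intro mult_nonneg_nonpos) (auto simp: a_def b_def)
    ultimately show "\<exists>D. (F has_real_derivative D) (at t) \<and> D \<le> 0" by blast
  next
    show "continuous_on {0..x} F"
      unfolding F_def a_def b_def by (intro continuous_intros) auto
  qed
  then show ?thesis by (simp add: F_def a_def b_def field_simps)
qed

lemma abs_sin_half_pi_cosh_le:
  fixes x y :: real
  assumes x: "0 \<le> x" and y: "0 \<le> y" "y < pi / 2"
  shows "\<bar>sin (pi / 2 * (cosh x * sin y))\<bar>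
    \<le> cosh (pi / 2 * (sinh x * cos y)) * sin (pi / 2 * sin y)"
proof (cases "cosh x * sin y \<le> 1")
  case True
  have "0 \<le> sin (pi / 2 * (cosh x * sin y))"
  proof (rule sin_ge_zero)
    have "pi / 2 * (cosh x * sin y) \<le> pi / 2 * 1" using True by (intro mult_left_mono) auto
    then show "pi / 2 * (cosh x * sin y) \<le> pi" using pi_gt_zero by linarith
  qed (use y in \<open>auto intro!: mult_nonneg_nonneg sin_ge_zero\<close>)
  with sin_half_pi_cosh_le[OF x y True] show ?thesis by simp
next
  case False
  have cosy: "0 < cos y" using y by (intro cos_gt_zero_pi) auto
  have "sin y \<noteq> 0" using False by force
  then have siny: "0 < sin y" using y sin_ge_zero[of y] by simp
  define t where "t = arcosh (1 / sin y)"
  have t: "0 \<le> t" "cosh t = 1 / sin y" using siny by (auto simp: t_def arcosh_nonneg_real)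
  have "cosh t \<le> cosh x" using False siny by (simp add: t field_simps)
  then have "t \<le> x" using cosh_real_nonneg_le_iff[OF t(1) x] by blast
  have "\<bar>sin (pi / 2 * (cosh x * sin y))\<bar> \<le> 1" by simp
  also have "1 \<le> cosh (pi / 2 * (sinh t * cos y)) * sin (pi / 2 * sin y)"
    using sin_half_pi_cosh_le[OF t(1) y] siny by (simp add: t)
  also have "\<dots> \<le> cosh (pi / 2 * (sinh x * cos y)) * sin (pi / 2 * sin y)"
  proof (rule mult_right_mono)
    show "cosh (pi / 2 * (sinh t * cos y)) \<le> cosh (pi / 2 * (sinh x * cos y))"
      using \<open>t \<le> x\<close> t x cosy by (simp add: cosh_real_nonneg_le_iff)
    have "pi / 2 * sin y \<le> pi / 2 * 1" by (intro mult_left_mono) auto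
    then have "pi / 2 * sin y \<le> pi" using pi_gt_zero by linarith
    then show "0 \<le> sin (pi / 2 * sin y)" using siny by (intro sin_ge_zero) auto
  qed
  finally show ?thesis .
qed

lemma Re_sinh: "Re (sinh z) = sinh (Re z) * cos (Im z)"
  and Im_sinh: "Im (sinh z) = cosh (Re z) * sin (Im z)"
  and Re_cosh: "Re (cosh z) = cosh (Re z) * cos (Im z)"
  and Im_cosh: "Im (cosh z) = sinh (Re z) * sin (Im z)"
  by (simp_all add: cosh_field_def sinh_field_def Re_exp Im_exp algebra_simps
      add_divide_distrib diff_divide_distrib)

lemma norm_cosh_squared: "(norm (cosh z))\<^sup>2 = (cosh (Re z))\<^sup>2 - (sin (Im z))\<^sup>2" for z :: complex
  by (simp add: cmod_power2 Re_cosh Im_cosh power_mult_distrib sinh_square_eq cos_squared_eq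
      algebra_simps)

lemma norm_cosh_le: "norm (cosh z) \<le> cosh (Re z)" for z :: complex
  by (rule power2_le_imp_le) (simp_all add: norm_cosh_squared)

lemma norm_cosh_half_pi_sinh_ge:
  fixes z :: complex
  assumes "\<bar>Im z\<bar> < pi / 2"
  shows "cosh (pi / 2 * (sinh (Re z) * cos (Im z))) * cos (pi / 2 * sin (Im z))
           \<le> norm (cosh (of_real (pi / 2) * sinh z))"
proof (rule power2_le_imp_le)
  define x y where "x = Re z" and "y = Im z"
  define A where "A = cosh (pi / 2 * (sinh x * cos y))"
  have "\<bar>sin (pi / 2 * (cosh \<bar>x\<bar> * sin \<bar>y\<bar>))\<bar>
      \<le> cosh (pi / 2 * (sinh \<bar>x\<bar> * cos \<bar>y\<bar>)) * sin (pi / 2 * sin \<bar>y\<bar>)"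
    using assms by (intro abs_sin_half_pi_cosh_le) (auto simp: y_def)
  then have "\<bar>sin (pi / 2 * (cosh x * sin y))\<bar> \<le> \<bar>A * sin (pi / 2 * sin y)\<bar>"
    by (cases "0 \<le> x"; cases "0 \<le> y") (auto simp: A_def)
  then have "(sin (pi / 2 * (cosh x * sin y)))\<^sup>2 \<le> (A * sin (pi / 2 * sin y))\<^sup>2"
    by (simp only: abs_le_square_iff)
  then have "(A * cos (pi / 2 * sin y))\<^sup>2 \<le> A\<^sup>2 - (sin (pi / 2 * (cosh x * sin y)))\<^sup>2"
    by (simp add: power_mult_distrib cos_squared_eq algebra_simps)
  then show "(cosh (pi / 2 * (sinh (Re z) * cos (Im z))) * cos (pi / 2 * sin (Im z)))\<^sup>2
      \<le> (norm (cosh (of_real (pi / 2) * sinh z)))\<^sup>2"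
    by (simp add: norm_cosh_squared Re_sinh Im_sinh A_def x_def y_def)
qed simp

section \<open>Tail sums of the double exponential weight\<close>

definition de_weight :: "real \<Rightarrow> real \<Rightarrow> real" where
  "de_weight a x = a * cosh x * exp (- (a * sinh x))"

definition de_tail :: "real \<Rightarrow> real \<Rightarrow> real \<Rightarrow> nat \<Rightarrow> real" where
  "de_tail a h x l = h * (\<Sum>j<l. de_weight a (x + real (Suc j) * h))"

lemma de_weight_nonneg: "0 \<le> a \<Longrightarrow> 0 \<le> de_weight a x"
  by (simp add: de_weight_def)

lemma DERIV_neg_exp_neg_sinh:
  "((\<lambda>x. - exp (- (a * sinh x))) has_real_derivative de_weight a x) (at x within A)"
  unfolding de_weight_def by (auto intro!: derivative_eq_intros)

lemma DERIV_de_weight: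
  "(de_weight a has_real_derivative a * exp (- (a * sinh x)) * (sinh x - a * (cosh x)\<^sup>2)) (at x)"
  unfolding de_weight_def
  by (auto intro!: derivative_eq_intros simp: algebra_simps power2_eq_square)

lemma de_weight_tendsto_0:
  assumes "0 < a"
  shows "(de_weight a \<longlongrightarrow> 0) at_top"
  unfolding de_weight_def[abs_def] cosh_field_def sinh_field_def using assms by real_asymp

lemma de_weight_antimono_onI:
  assumes "0 \<le> a" "is_interval A" and sinh_le: "\<And>t. t \<in> A \<Longrightarrow> sinh t \<le> a * (cosh t)\<^sup>2"
  shows "antimono_on A (de_weight a)"
proof (rule monotone_onI)
  fix x y assume xy: "x \<in> A" "y \<in> A" "x \<le> y"
  show "de_weight a y \<le> de_weight a x"
  proof (rule DERIV_nonpos_imp_nonincreasing [OF xy(3)])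
    fix t assume "x \<le> t" "t \<le> y"
    then have "t \<in> A" using assms(2) xy by (meson mem_is_interval_1_I)
    then have "a * exp (- (a * sinh t)) * (sinh t - a * (cosh t)\<^sup>2) \<le> 0"
      using sinh_le assms(1) by (intro mult_nonneg_nonpos) auto
    then show "\<exists>D. (de_weight a has_real_derivative D) (at t) \<and> D \<le> 0"
      using DERIV_de_weight by blast
  qed
qed

lemma de_weight_mono_onI:
  assumes "0 \<le> a" "is_interval A" and sinh_ge: "\<And>t. t \<in> A \<Longrightarrow> a * (cosh t)\<^sup>2 \<le> sinh t"
  shows "mono_on A (de_weight a)"
proof (rule mono_onI)
  fix x y assume xy: "x \<in> A" "y \<in> A" "x \<le> y"
  show "de_weight a x \<le> de_weight a y"
  proof (rule DERIV_nonneg_imp_nondecreasing [OF xy(3)])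
    fix t assume "x \<le> t" "t \<le> y"
    then have "t \<in> A" using assms(2) xy by (meson mem_is_interval_1_I)
    then have "0 \<le> a * exp (- (a * sinh t)) * (sinh t - a * (cosh t)\<^sup>2)"
      using sinh_ge assms(1) by (intro mult_nonneg_nonneg) auto
    then show "\<exists>D. (de_weight a has_real_derivative D) (at t) \<and> 0 \<le> D"
      using DERIV_de_weight by blast
  qed
qed

lemma antimono_de_weight:
  assumes "1 / 2 \<le> a"
  shows "antimono (de_weight a)"
proof (rule de_weight_antimono_onI)
  fix t :: real
  have "0 \<le> (sinh t - 1)\<^sup>2" by simp
  then have "sinh t \<le> 1 / 2 * (cosh t)\<^sup>2"
    unfolding cosh_square_eq by (simp add: power2_eq_square algebra_simps)
  also have "\<dots> \<le> a * (cosh t)\<^sup>2" using assms by (intro mult_right_mono) auto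
  finally show "sinh t \<le> a * (cosh t)\<^sup>2" .
qed (use assms in auto)

text \<open>The critical points of \<open>de_weight a\<close> are given by the two roots, with product 1, of a
  quadratic equation for \<open>sinh p\<close>. The weight has its local maximum at the larger one.\<close>

definition de_peak :: "real \<Rightarrow> real \<Rightarrow> bool" where
  "de_peak a p \<longleftrightarrow> a * (cosh p)\<^sup>2 = sinh p \<and> 1 \<le> sinh p"

lemma de_peakD:
  assumes "de_peak a p"
  shows "a * (cosh p)\<^sup>2 = sinh p" "1 \<le> sinh p" "1 / sinh p \<le> 1"
proof -
  show "a * (cosh p)\<^sup>2 = sinh p" "1 \<le> sinh p" using assms by (auto simp: de_peak_def)
  then show "1 / sinh p \<le> 1" using frac_le[of 1 1 1 "sinh p"] by simp
qed

lemma de_peak_factorization: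
  assumes "de_peak a p"
  shows "a * (cosh t)\<^sup>2 - sinh t = a * ((sinh t - sinh p) * (sinh t - 1 / sinh p))"
proof -
  have p: "a * (sinh p)\<^sup>2 + a = sinh p"
    using de_peakD(1)[OF assms] by (simp add: cosh_square_eq algebra_simps)
  have "sinh p \<noteq> 0" using de_peakD(2)[OF assms] by linarith
  with p have "a * (sinh p + 1 / sinh p) = 1" by (simp add: field_simps power2_eq_square)
  then have "a * (sinh t)\<^sup>2 + a - a * (sinh p + 1 / sinh p) * sinh t = a * (cosh t)\<^sup>2 - sinh t"
    by (simp add: cosh_square_eq algebra_simps)
  moreover have "a * ((sinh t - sinh p) * (sinh t - 1 / sinh p))
      = a * (sinh t)\<^sup>2 + a - a * (sinh p + 1 / sinh p) * sinh t"
    using \<open>sinh p \<noteq> 0\<close> by (simp add: field_simps power2_eq_square)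
  ultimately show ?thesis by simp
qed

lemma antimono_on_de_weight_peak:
  assumes a: "0 < a" and p: "de_peak a p"
  shows "antimono_on {p..} (de_weight a)"
proof (rule de_weight_antimono_onI)
  fix t assume t: "t \<in> {p..}"
  have "sinh p \<le> sinh t" using t by simp
  then have "0 \<le> a * ((sinh t - sinh p) * (sinh t - 1 / sinh p))"
    using a de_peakD[OF p] by (intro mult_nonneg_nonneg) linarith+
  then show "sinh t \<le> a * (cosh t)\<^sup>2" using de_peak_factorization[OF p, of t] by simp
qed (use a in \<open>auto simp: is_interval_ci\<close>)

lemma mono_on_de_weight_peak:
  assumes a: "0 < a" and p: "de_peak a p" and x: "1 \<le> sinh x"
  shows "mono_on {x..p} (de_weight a)"
proof (rule de_weight_mono_onI)
  fix t assume t: "t \<in> {x..p}"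
  have "sinh x \<le> sinh t" "sinh t \<le> sinh p" using t by simp_all
  then have "a * ((sinh t - sinh p) * (sinh t - 1 / sinh p)) \<le> 0"
    using a x de_peakD(3)[OF p] by (intro mult_nonneg_nonpos mult_nonpos_nonneg) linarith+
  then show "a * (cosh t)\<^sup>2 \<le> sinh t" using de_peak_factorization[OF p, of t] by simp
qed (use a in \<open>auto simp: is_interval_cc\<close>)

lemma de_weight_le_peak:
  assumes a: "0 < a" and p: "de_peak a p" and x: "1 \<le> sinh x"
  shows "de_weight a x \<le> de_weight a p"
proof (cases "x \<le> p")
  case True
  then show ?thesis by (intro mono_onD[OF mono_on_de_weight_peak[OF a p x]]) auto
next
  case False
  then show ?thesis by (intro monotone_onD[OF antimono_on_de_weight_peak[OF a p]]) auto
qed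

lemma mult_de_weight_le:
  assumes anti: "antimono_on {x..y} (de_weight a)" and "x \<le> y"
  shows "(y - x) * de_weight a y \<le> exp (- (a * sinh x)) - exp (- (a * sinh y))"
proof (cases "x = y")
  case False
  then have "x < y" using assms by simp
  then obtain z where z: "x < z" "z < y"
    "(- exp (- (a * sinh y))) - (- exp (- (a * sinh x))) = (y - x) * de_weight a z"
    using MVT2[of x y "\<lambda>x. - exp (- (a * sinh x))" "de_weight a"] DERIV_neg_exp_neg_sinh by blast
  have "(y - x) * de_weight a y \<le> (y - x) * de_weight a z"
    using z by (intro mult_left_mono monotone_onD[OF anti]) auto
  then show ?thesis using z by simp
qed auto

lemma sum_le_potential:
  fixes F \<Phi> :: "real \<Rightarrow> real"
  assumes h: "0 < h" and step: "\<And>x y. x0 \<le> x \<Longrightarrow> x \<le> y \<Longrightarrow> (y - x) * F y \<le> \<Phi> x - \<Phi> y"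
    and nonneg: "\<And>x. x0 \<le> x \<Longrightarrow> 0 \<le> \<Phi> x"
  shows "h * (\<Sum>j<l. F (x0 + real (Suc j) * h)) \<le> \<Phi> x0"
proof -
  have "h * (\<Sum>j<l. F (x0 + real (Suc j) * h)) = (\<Sum>j<l. h * F (x0 + real (Suc j) * h))"
    by (simp add: sum_distrib_left)
  also have "\<dots> \<le> (\<Sum>j<l. \<Phi> (x0 + real j * h) - \<Phi> (x0 + real (Suc j) * h))"
  proof (rule sum_mono)
    fix j :: nat
    show "h * F (x0 + real (Suc j) * h) \<le> \<Phi> (x0 + real j * h) - \<Phi> (x0 + real (Suc j) * h)"
      using step[of "x0 + real j * h" "x0 + real (Suc j) * h"] h by (simp add: algebra_simps)
  qed
  also have "\<dots> = \<Phi> x0 - \<Phi> (x0 + real l * h)"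
    by (subst sum_lessThan_telescope') simp
  also have "\<dots> \<le> \<Phi> x0" using nonneg[of "x0 + real l * h"] h by simp
  finally show ?thesis .
qed

lemma de_tail_le_of_antimono:
  assumes h: "0 < h" and anti: "antimono_on {x..} (de_weight a)"
  shows "de_tail a h x l \<le> exp (- (a * sinh x))"
  unfolding de_tail_def
proof (rule sum_le_potential[OF h])
  fix u v assume "x \<le> u" "u \<le> v"
  then show "(v - u) * de_weight a v \<le> exp (- (a * sinh u)) - exp (- (a * sinh v))"
    by (intro mult_de_weight_le monotone_on_subset[OF anti]) auto
qed simp

text \<open>The integral of the weight over \<open>{x..}\<close>, with the weight raised to its maximum on \<open>{x..p}\<close>.\<close>

definition de_potential :: "real \<Rightarrow> real \<Rightarrow> real \<Rightarrow> real" where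
  "de_potential a p x = (if p \<le> x then exp (- (a * sinh x))
     else exp (- (a * sinh p)) + (p - x) * de_weight a p)"

lemma mult_de_weight_le_potential_diff:
  assumes a: "0 < a" and p: "de_peak a p" and x: "1 \<le> sinh x" and "x \<le> y"
  shows "(y - x) * de_weight a y \<le> de_potential a p x - de_potential a p y"
proof -
  have y: "1 \<le> sinh y" using x \<open>x \<le> y\<close> sinh_real_le_iff[of x y] by linarith
  have right: "(y - u) * de_weight a y \<le> exp (- (a * sinh u)) - exp (- (a * sinh y))"
    if "p \<le> u" "u \<le> y" for u
    using that
    by (intro mult_de_weight_le monotone_on_subset[OF antimono_on_de_weight_peak[OF a p]]) auto
  have left: "u * de_weight a y \<le> u * de_weight a p" if "0 \<le> u" for u
    using that de_weight_le_peak[OF a p y] by (intro mult_left_mono)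
  consider "p \<le> x" | "x < p" "y \<le> p" | "x < p" "p < y" by linarith
  then show ?thesis
  proof cases
    case 1
    then show ?thesis using right[of x] \<open>x \<le> y\<close> by (simp add: de_potential_def)
  next
    case 2
    then have "de_potential a p x - de_potential a p y = (y - x) * de_weight a p"
      by (cases "y = p") (auto simp: de_potential_def algebra_simps)
    then show ?thesis using left[of "y - x"] \<open>x \<le> y\<close> by simp
  next
    case 3
    then show ?thesis
      using left[of "p - x"] right[of p] by (simp add: de_potential_def algebra_simps)
  qed
qed

lemma de_tail_le_potential:
  assumes a: "0 < a" and h: "0 < h" and p: "de_peak a p" and x: "1 \<le> sinh x"
  shows "de_tail a h x l \<le> de_potential a p x"
  unfolding de_tail_def
proof (rule sum_le_potential[OF h])
  fix u v assume uv: "x \<le> u" "u \<le> v"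
  have "1 \<le> sinh u" using x uv sinh_real_le_iff[of x u] by linarith
  then show "(v - u) * de_weight a v \<le> de_potential a p u - de_potential a p v"
    using uv by (intro mult_de_weight_le_potential_diff[OF a p])
next
  fix u
  show "0 \<le> de_potential a p u"
    using a by (auto simp: de_potential_def
        intro!: add_nonneg_nonneg mult_nonneg_nonneg de_weight_nonneg)
qed

text \<open>The threshold \<open>xg (a / pi)\<close> lies to the left of the peak of the weight when \<open>a < 1 / 2\<close>,
  but by a factor of at most \<open>sqrt 2\<close> in \<open>sinh\<close>. This costs the factor
  \<open>41 / 50 < 1 - (sqrt 2 - 1)\<^sup>2\<close> in the exponent.\<close>

lemma exists_de_peak:
  assumes "0 < a" "a < 1 / 2"
  obtains p where "de_peak a p" "sinh p \<le> sqrt 2 * sinh (xg (a / pi))"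
proof
  define c where "c = 2 * a"
  define r where "r = sqrt (1 - c\<^sup>2)"
  define p where "p = arsinh ((1 + r) / c)"
  have c: "0 < c" "c < 1" using assms by (auto simp: c_def)
  have r: "0 \<le> r" "r \<le> 1" "r\<^sup>2 = 1 - c\<^sup>2" using c by (auto simp: r_def abs_square_le_1)
  have sinh_p: "sinh p = (1 + r) / c" by (simp add: p_def)
  have square_eq: "(1 + r)\<^sup>2 = 2 * (1 + r) - c\<^sup>2"
    using r(3) by (simp add: power2_eq_square algebra_simps)
  have "c / 2 * (((1 + r) / c)\<^sup>2 + 1) = (1 + r) / c"
    unfolding power_divide square_eq using c by (simp add: field_simps power2_eq_square)
  then have "a * (cosh p)\<^sup>2 = sinh p" unfolding cosh_square_eq sinh_p by (simp add: c_def)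
  moreover have "1 \<le> sinh p" unfolding sinh_p using c r by simp
  ultimately show "de_peak a p" by (simp add: de_peak_def)
  have xg: "sinh (xg (a / pi)) = sqrt (1 + r) / c"
    using c by (simp add: xg_def c_def r_def field_simps)
  have "sqrt (1 + r) * (sqrt (1 + r) / c) \<le> sqrt 2 * (sqrt (1 + r) / c)"
    using r c by (intro mult_right_mono) auto
  then show "sinh p \<le> sqrt 2 * sinh (xg (a / pi))" unfolding xg sinh_p using r by simp
qed

lemma diff_mult_cosh_le:
  fixes x p :: real
  assumes x: "0 < x" "x \<le> p" and sinh_le: "sinh p \<le> sqrt 2 * sinh x"
  shows "(p - x) * cosh p \<le> sinh p - 41 / 50 * sinh x"
proof -
  define \<rho> where "\<rho> = sinh p / sinh x"
  have "sinh x \<le> sinh p" using x by simp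
  then have \<rho>: "1 \<le> \<rho>" "\<rho> \<le> sqrt 2" and sinh_p: "sinh p = \<rho> * sinh x"
    using sinh_le x by (auto simp: \<rho>_def pos_divide_le_eq pos_le_divide_eq)
  have secant: "(p - x) * cosh x \<le> sinh p - sinh x"
  proof (cases "x = p")
    case False
    then obtain z where z: "x < z" "sinh p - sinh x = (p - x) * cosh z"
      using MVT2[of x p sinh cosh] x has_field_derivative_sinh[OF DERIV_ident] by auto
    then have "cosh x \<le> cosh z" using x by (simp add: cosh_real_nonneg_le_iff)
    then show ?thesis using z x by (simp add: mult_left_mono)
  qed simp
  have "cosh p \<le> \<rho> * cosh x"
  proof (rule power2_le_imp_le)
    have "1 \<le> \<rho>\<^sup>2" using \<rho> by simp
    then show "(cosh p)\<^sup>2 \<le> (\<rho> * cosh x)\<^sup>2"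
      by (simp add: power_mult_distrib cosh_square_eq sinh_p algebra_simps)
  qed (use \<rho> in auto)
  then have "(p - x) * cosh p \<le> (p - x) * (\<rho> * cosh x)" using x by (intro mult_left_mono) auto
  also have "\<dots> \<le> \<rho> * (sinh p - sinh x)"
    using mult_left_mono[OF secant, of \<rho>] \<rho> by (simp add: mult_ac)
  also have "\<dots> = sinh p - (1 - (\<rho> - 1)\<^sup>2) * sinh x"
    unfolding sinh_p by (simp add: power2_eq_square algebra_simps)
  also have "\<dots> \<le> sinh p - 41 / 50 * sinh x"
  proof -
    have "sqrt 2 \<le> 1.42" by (rule real_le_lsqrt) (auto simp: power2_eq_square)
    then have "(\<rho> - 1)\<^sup>2 \<le> 0.42\<^sup>2" using \<rho> by (intro power_mono) auto
    then have "41 / 50 \<le> 1 - (\<rho> - 1)\<^sup>2" by (simp add: power2_eq_square)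
    then show ?thesis using x by (intro diff_left_mono mult_right_mono) auto
  qed
  finally show ?thesis .
qed

lemma de_tail_le_exp_sinh_left_of_peak:
  assumes a: "0 < a" and h: "0 < h" and x: "1 \<le> sinh x" "x < p"
    and p: "de_peak a p" "sinh p \<le> sqrt 2 * sinh x"
  shows "de_tail a h x l \<le> exp (- (a * (41 / 50 * sinh x)))"
proof -
  have "0 < sinh x" using x(1) by linarith
  then have "0 < x" by simp
  have "de_tail a h x l \<le> exp (- (a * sinh p)) * (1 + a * ((p - x) * cosh p))"
    using de_tail_le_potential[OF a h p(1) x(1), of l] x(2)
    by (simp add: de_potential_def de_weight_def algebra_simps)
  also have "\<dots> \<le> exp (- (a * sinh p)) * exp (a * (sinh p - 41 / 50 * sinh x))"
  proof (intro mult_left_mono order_trans[OF exp_ge_add_one_self])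
    show "exp (a * ((p - x) * cosh p)) \<le> exp (a * (sinh p - 41 / 50 * sinh x))"
      unfolding exp_le_cancel_iff
      using diff_mult_cosh_le[OF \<open>0 < x\<close> _ p(2)] x(2) a by (intro mult_left_mono) auto
  qed auto
  also have "\<dots> = exp (- (a * (41 / 50 * sinh x)))"
    unfolding exp_add[symmetric] by (simp add: algebra_simps)
  finally show ?thesis .
qed

lemma de_tail_le_exp_sinh:
  assumes a: "0 < a" and h: "0 < h" and x: "1 \<le> sinh x" and xg: "xg (a / pi) \<le> x"
  shows "de_tail a h x l \<le> exp (- (a * (41 / 50 * sinh x)))"
proof -
  have antimono_case: ?thesis if "antimono_on {x..} (de_weight a)"
  proof -
    have "a * (41 / 50 * sinh x) \<le> a * sinh x" using a x by (intro mult_left_mono) linarith+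
    then have "exp (- (a * sinh x)) \<le> exp (- (a * (41 / 50 * sinh x)))" by simp
    with de_tail_le_of_antimono[OF h that, of l] show ?thesis by linarith
  qed
  show ?thesis
  proof (cases "1 / 2 \<le> a")
    case True
    then show ?thesis by (intro antimono_case monotone_on_subset[OF antimono_de_weight]) auto
  next
    case False
    then obtain p where p: "de_peak a p" and "sinh p \<le> sqrt 2 * sinh (xg (a / pi))"
      using a exists_de_peak[of a] by auto
    moreover have "sqrt 2 * sinh (xg (a / pi)) \<le> sqrt 2 * sinh x" using xg by simp
    ultimately have sinh_p: "sinh p \<le> sqrt 2 * sinh x" by linarith
    show ?thesis
    proof (cases "p \<le> x")
      case True
      then show ?thesis
        by (intro antimono_case monotone_on_subset[OF antimono_on_de_weight_peak[OF a p]]) auto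
    next
      case False
      then show ?thesis using p sinh_p by (intro de_tail_le_exp_sinh_left_of_peak[OF a h x]) auto
    qed
  qed
qed

lemma exp_divide_self_le_sinh:
  fixes x :: real
  assumes "1 \<le> x"
  shows "exp x / x - 1 \<le> 41 / 25 * sinh x"
proof -
  define p q where "p = exp x" and "q = exp (- x)"
  have pq: "1 \<le> p" "0 < q" "q \<le> 1" "p * q = 1"
    using assms by (auto simp: p_def q_def simp flip: exp_add)
  have "p / x - 1 \<le> 41 / 50 * (p - q)"
  proof (cases "5 / 4 \<le> x")
    case True
    then have "p / x \<le> p / (5 / 4)" using pq by (intro divide_left_mono) auto
    also have "\<dots> = 4 / 5 * p" by simp
    finally show ?thesis using pq by (simp add: right_diff_distrib)
  next
    case False
    then have "p \<le> exp (1 + 1 / 4)" by (simp add: p_def)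
    also have "\<dots> = exp 1 * exp (1 / 4 :: real)" by (rule exp_add)
    also have "\<dots> \<le> 2.72 * (1 + 1 / 4 + (1 / 4)\<^sup>2)"
      using e_less_272 exp_bound[of "1/4 :: real"] by (intro mult_mono) auto
    also have "\<dots> \<le> 4" by (simp add: power2_eq_square)
    finally have "p \<le> 4" .
    have "p / x \<le> p / 1" using assms pq by (intro divide_left_mono) auto
    moreover have "0 \<le> (1 - q) * (41 / 50 - 9 / 50 * p)"
      using pq \<open>p \<le> 4\<close> by (intro mult_nonneg_nonneg) auto
    moreover have "\<dots> = 1 - 9 / 50 * p - 41 / 50 * q"
      using pq(4) by (simp add: field_simps)
    ultimately show ?thesis by (simp only: right_diff_distrib)
  qed
  moreover have "sinh x = (p - q) / 2" by (simp add: sinh_field_def p_def q_def)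
  ultimately show ?thesis unfolding p_def[symmetric] by linarith
qed

lemma de_tail_le_exp_exp:
  assumes a: "0 < a" and h: "0 < h" and x: "1 \<le> x" and xg: "xg (a / pi) \<le> x"
  shows "de_tail a h x l \<le> exp (a / 2 * (1 - exp x / x))"
proof -
  have "a / 2 * (exp x / x - 1) \<le> a / 2 * (41 / 25 * sinh x)"
    using a by (intro mult_left_mono exp_divide_self_le_sinh x) auto
  then have "exp (- (a * (41 / 50 * sinh x))) \<le> exp (a / 2 * (1 - exp x / x))"
    by (simp add: right_diff_distrib)
  moreover have "1 \<le> sinh x" using x real_le_x_sinh[of x] by (simp add: sinh_field_def exp_minus)
  then have "de_tail a h x l \<le> exp (- (a * (41 / 50 * sinh x)))"
    using a h xg by (intro de_tail_le_exp_sinh)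
  ultimately show ?thesis by linarith
qed

section \<open>Contour integrals over rectangles\<close>

lemma has_contour_integral_linepath_same_Im_iff:
  assumes "a < b"
  shows "(f has_contour_integral I) (linepath (Complex a c) (Complex b c)) \<longleftrightarrow>
           ((\<lambda>x. f (Complex x c)) has_integral I) {a..b}"
proof -
  have shift: "linepath (Complex a c) (Complex b c) x
      = linepath (of_real a) (of_real b) x + \<i> * of_real c" for x
    by (simp add: linepath_def complex_eq_iff algebra_simps)
  have diff: "Complex b c - Complex a c = of_real b - of_real a" by (simp add: complex_eq_iff)
  have "(f has_contour_integral I) (linepath (Complex a c) (Complex b c)) \<longleftrightarrow>
          ((\<lambda>z. f (z + \<i> * of_real c)) has_contour_integral I) (linepath (of_real a) (of_real b))"
    unfolding has_contour_integral_linepath shift diff ..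
  also have "\<dots> \<longleftrightarrow> ((\<lambda>x. f (of_real x + \<i> * of_real c)) has_integral I) {a..b}"
    using assms by (subst has_contour_integral_linepath_Reals_iff) auto
  finally show ?thesis by (simp add: Complex_eq)
qed

lemma has_integral_linepath_same_Im:
  assumes "a < b" and "continuous_on (closed_segment (Complex a c) (Complex b c)) f"
  shows "((\<lambda>x. f (Complex x c)) has_integral
           contour_integral (linepath (Complex a c) (Complex b c)) f) {a..b}"
  using has_contour_integral_linepath_same_Im_iff[OF assms(1)]
    has_contour_integral_integral[OF contour_integrable_continuous_linepath[OF assms(2)]] by blast

lemma norm_contour_integral_same_Im_le:
  assumes "a < b" and "continuous_on (closed_segment (Complex a c) (Complex b c)) f"
    and B: "\<And>x. a \<le> x \<Longrightarrow> x \<le> b \<Longrightarrow> norm (f (Complex x c)) \<le> B x" "B integrable_on {a..b}"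
  shows "norm (contour_integral (linepath (Complex a c) (Complex b c)) f) \<le> integral {a..b} B"
proof -
  note I = has_integral_linepath_same_Im[OF assms(1,2)]
  show ?thesis
    using integral_norm_bound_integral[OF has_integral_integrable[OF I] B(2)] B(1)
      integral_unique[OF I] by simp
qed

lemma norm_contour_integral_same_Re_le:
  assumes "a \<le> b" and "continuous_on (closed_segment (Complex c a) (Complex c b)) f"
    and bound: "\<And>t. a \<le> t \<Longrightarrow> t \<le> b \<Longrightarrow> norm (f (Complex c t)) \<le> B"
  shows "norm (contour_integral (linepath (Complex c a) (Complex c b)) f) \<le> B * (b - a)"
proof -
  have "norm (contour_integral (linepath (Complex c a) (Complex c b)) f)
      \<le> B * norm (Complex c b - Complex c a)"
  proof (rule contour_integral_bound_linepath)
    show "f contour_integrable_on linepath (Complex c a) (Complex c b)"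
      using assms(2) by (rule contour_integrable_continuous_linepath)
    show "0 \<le> B" using order_trans[OF norm_ge_zero bound[of a]] assms(1) by simp
    fix z assume "z \<in> closed_segment (Complex c a) (Complex c b)"
    then have "z = Complex c (Im z)" "a \<le> Im z" "Im z \<le> b"
      using assms(1)
      by (auto simp: closed_segment_same_Re closed_segment_eq_real_ivl complex_eq_iff)
    then show "norm (f z) \<le> B" using bound[of "Im z"] by simp
  qed
  also have "norm (Complex c b - Complex c a) = b - a" using assms(1) by (simp add: cmod_def)
  finally show ?thesis .
qed

lemma contour_integral_rectpath:
  assumes "continuous_on (path_image (rectpath a1 a3)) f"
  defines "a2 \<equiv> Complex (Re a3) (Im a1)" and "a4 \<equiv> Complex (Re a1) (Im a3)"
  shows "contour_integral (rectpath a1 a3) f =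
    contour_integral (linepath a1 a2) f + contour_integral (linepath a2 a3) f
    - contour_integral (linepath a4 a3) f - contour_integral (linepath a1 a4) f"
proof -
  have "path_image (rectpath a1 a3) = closed_segment a1 a2 \<union> closed_segment a2 a3
          \<union> closed_segment a3 a4 \<union> closed_segment a4 a1"
    by (simp add: rectpath_def Let_def path_image_join a2_def a4_def Un_assoc)
  then have int: "f contour_integrable_on linepath a1 a2" "f contour_integrable_on linepath a2 a3"
    "f contour_integrable_on linepath a3 a4" "f contour_integrable_on linepath a4 a1"
    using assms(1)
    by (auto intro!: contour_integrable_continuous_linepath elim: continuous_on_subset)
  have "contour_integral (rectpath a1 a3) f =
    contour_integral (linepath a1 a2) f + (contour_integral (linepath a2 a3) f
    + (contour_integral (linepath a3 a4) f + contour_integral (linepath a4 a1) f))"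
    using int by (simp add: rectpath_def Let_def flip: a2_def a4_def)
  moreover have "contour_integral (linepath a3 a4) f = - contour_integral (linepath a4 a3) f"
    "contour_integral (linepath a4 a1) f = - contour_integral (linepath a1 a4) f"
    using contour_integral_reversepath[of "linepath a4 a3" f]
      contour_integral_reversepath[of "linepath a1 a4" f] by simp_all
  ultimately show ?thesis by simp
qed

lemma convex_strip: "convex (strip d)"
proof -
  have "strip d = {z. Im z < d} \<inter> {z. Im z > - d}" by (auto simp: strip_def)
  then show ?thesis by (simp add: convex_Int convex_halfspace_Im_lt convex_halfspace_Im_gt)
qed

lemma open_strip: "open (strip d)"
  unfolding strip_def by (intro open_Collect_less continuous_intros)

section \<open>The kernel with poles at the grid points\<close>

lemma residue_divide_simple_zero:
  assumes S: "open S" "p \<in> S" and holo: "g holomorphic_on S" "D holomorphic_on S"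
    and D: "D p = 0" "\<And>z. z \<in> S - {p} \<Longrightarrow> D z \<noteq> 0"
    and D': "(D has_field_derivative D') (at p)" "D' \<noteq> 0"
  shows "residue (\<lambda>z. g z / D z) p = g p / D'"
proof (rule residue_simple'[OF S])
  show "(\<lambda>z. g z / D z) holomorphic_on S - {p}"
    using D(2) by (intro holomorphic_on_divide holo[THEN holomorphic_on_subset]) auto
  have "((\<lambda>z. (D z - D p) / (z - p)) \<longlongrightarrow> D') (at p)"
    using D'(1) by (simp add: has_field_derivative_iff)
  moreover have "isCont g p"
    using holomorphic_on_imp_continuous_on[OF holo(1)] S continuous_on_eq_continuous_at by blast
  then have "(g \<longlongrightarrow> g p) (at p)" by (simp add: isCont_def)
  ultimately have "((\<lambda>z. g z / ((D z - D p) / (z - p))) \<longlongrightarrow> g p / D') (at p)"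
    using D'(2) by (intro tendsto_divide)
  then show "((\<lambda>z. g z / D z * (z - p)) \<longlongrightarrow> g p / D') (at p)" by (simp add: D(1))
qed

definition grid_exp :: "real \<Rightarrow> complex \<Rightarrow> complex" where
  "grid_exp h z = exp (- (2 * pi * \<i> / h) * z)"

definition grid_kernel :: "real \<Rightarrow> complex \<Rightarrow> complex" where
  "grid_kernel h z = 1 / (1 - grid_exp h z)"

lemma norm_grid_exp: "norm (grid_exp h z) = exp (2 * pi * Im z / h)"
  by (simp add: grid_exp_def)

lemma grid_exp_eq_1_iff:
  assumes "0 < h"
  shows "grid_exp h z = 1 \<longleftrightarrow> (\<exists>k::int. z = of_real (of_int k * h))"
proof
  assume "grid_exp h z = 1"
  then obtain k :: int
    where "Re (- (2 * pi * \<i> / h) * z) = 0" "Im (- (2 * pi * \<i> / h) * z) = of_int (2 * k) * pi"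
    by (auto simp: grid_exp_def exp_eq_1)
  then have "Im z = 0" "pi * (Re z + of_int k * h) = 0" using assms by (auto simp: field_simps)
  then have "z = of_real (of_int (- k) * h)" by (simp add: complex_eq_iff)
  then show "\<exists>k::int. z = of_real (of_int k * h)" by blast
next
  assume "\<exists>k::int. z = of_real (of_int k * h)"
  then obtain k :: int where "z = of_real (of_int k * h)" by blast
  then show "grid_exp h z = 1"
    using assms exp_integer_2pi[of "of_int (- k)"] by (simp add: grid_exp_def mult_ac)
qed

lemma grid_exp_neq_1: "0 < h \<Longrightarrow> Im z \<noteq> 0 \<Longrightarrow> grid_exp h z \<noteq> 1"
  using grid_exp_eq_1_iff[of h z] by auto

lemma grid_exp_midpoint:
  assumes "0 < h"
  shows "grid_exp h (Complex ((of_int k + 1 / 2) * h) t) = - of_real (exp (2 * pi * t / h))"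
proof -
  have "grid_exp h (Complex ((of_int k + 1 / 2) * h) t)
      = grid_exp h (of_real (of_int k * h)) * of_real (exp (2 * pi * t / h)) * exp (- (\<i> * pi))"
    unfolding grid_exp_def exp_of_real[symmetric] exp_add[symmetric] using assms
    by (intro arg_cong[of _ _ exp]) (simp add: complex_eq_iff field_simps)
  also have "grid_exp h (of_real (of_int k * h)) = 1" using grid_exp_eq_1_iff[OF assms] by blast
  finally show ?thesis by (simp add: exp_minus)
qed

lemma DERIV_one_minus_grid_exp:
  assumes "0 < h"
  shows "((\<lambda>z. 1 - grid_exp h z) has_field_derivative 2 * pi * \<i> / h * grid_exp h z) (at z)"
  unfolding grid_exp_def using assms by (auto intro!: derivative_eq_intros)

lemma holomorphic_grid_exp: "grid_exp h holomorphic_on A"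
  unfolding grid_exp_def[abs_def] by (intro holomorphic_intros)

lemma residue_grid_kernel:
  assumes h: "0 < h" and S: "open S" "of_real (real_of_int k * h) \<in> S"
    and holo: "g holomorphic_on S"
  shows "residue (\<lambda>z. g z * grid_kernel h z) (of_real (real_of_int k * h))
           = g (of_real (real_of_int k * h)) * h / (2 * pi * \<i>)"
proof -
  define p where "p = complex_of_real (real_of_int k * h)"
  define T where "T = S \<inter> ball p h"
  have p: "grid_exp h p = 1" using grid_exp_eq_1_iff[OF h] by (auto simp: p_def)
  have "grid_exp h z \<noteq> 1" if z: "z \<in> T - {p}" for z
  proof
    assume "grid_exp h z = 1"
    then obtain j :: int where j: "z = of_real (of_int j * h)"
      using grid_exp_eq_1_iff[OF h] by blast
    have "dist p z = \<bar>of_int (k - j)\<bar> * h"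
      using h
      by (simp add: p_def j dist_norm abs_mult flip: of_real_mult of_real_diff left_diff_distrib)
    moreover have "dist p z < 1 * h" using z by (simp add: T_def)
    ultimately have "\<bar>real_of_int (k - j)\<bar> < 1" using h by (simp only: mult_less_cancel_right_pos)
    then have "k = j" by linarith
    then show False using z j by (simp add: p_def)
  qed
  moreover have "open T" "p \<in> T" "g holomorphic_on T"
    using S h by (auto simp: T_def p_def intro: holomorphic_on_subset[OF holo])
  ultimately have "residue (\<lambda>z. g z / (1 - grid_exp h z)) p = g p / (2 * pi * \<i> / h)"
    using h p DERIV_one_minus_grid_exp[OF h, of p]
    by (intro residue_divide_simple_zero[of T] holomorphic_intros holomorphic_grid_exp) auto
  then show ?thesis by (simp add: p_def grid_kernel_def)
qed

lemma norm_grid_kernel_le_above: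
  assumes "0 < h" "0 < Im z"
  shows "norm (grid_kernel h z) \<le> 1 / (exp (2 * pi * Im z / h) - 1)"
proof -
  have "exp (2 * pi * Im z / h) - 1 \<le> norm (1 - grid_exp h z)"
    using norm_triangle_ineq2[of "grid_exp h z" 1] by (simp add: norm_grid_exp norm_minus_commute)
  moreover have "0 < exp (2 * pi * Im z / h) - 1" using assms by simp
  ultimately show ?thesis
    unfolding grid_kernel_def norm_divide norm_one by (intro divide_left_mono mult_pos_pos) auto
qed

lemma norm_grid_kernel_minus_1_le_below:
  assumes "0 < h" "Im z < 0"
  shows "norm (grid_kernel h z - 1) \<le> 1 / (exp (2 * pi * (- Im z) / h) - 1)"
proof -
  have "grid_exp h (- z) * grid_exp h z = 1" by (simp add: grid_exp_def flip: exp_add)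
  moreover have "grid_exp h z \<noteq> 1" "grid_exp h (- z) \<noteq> 1"
    using assms by (simp_all add: grid_exp_neq_1)
  ultimately have "grid_kernel h z - 1 = - grid_kernel h (- z)"
    unfolding grid_kernel_def by (simp add: divide_simps) (simp add: algebra_simps)
  then show ?thesis using norm_grid_kernel_le_above[of h "- z"] assms by simp
qed

lemma norm_grid_kernel_le_midpoint:
  assumes "0 < h"
  shows "norm (grid_kernel h (Complex ((of_int k + 1 / 2) * h) t)) \<le> 1"
proof -
  have "1 - grid_exp h (Complex ((of_int k + 1 / 2) * h) t) = of_real (1 + exp (2 * pi * t / h))"
    by (simp add: grid_exp_midpoint[OF assms])
  then have "norm (1 - grid_exp h (Complex ((of_int k + 1 / 2) * h) t)) = 1 + exp (2 * pi * t / h)"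
    by (metis norm_of_real abs_of_pos add_pos_pos exp_gt_zero zero_less_one)
  then show ?thesis by (simp add: grid_kernel_def norm_divide divide_le_eq add_pos_pos)
qed

section \<open>Trapezoidal sums as contour integrals\<close>

locale trapezoidal_rectangle =
  fixes g :: "complex \<Rightarrow> complex" and d h y :: real and m :: nat
  assumes holo: "g holomorphic_on strip d" and h: "0 < h" and y: "0 < y" "y < d"
begin

text \<open>The vertical sides run midway between grid points, where the kernel is bounded by 1.\<close>

definition half_width :: real where
  "half_width = (real m + 1 / 2) * h"

definition grid :: "complex set" where
  "grid = (\<lambda>k. of_real (real_of_int k * h)) ` {- int m..int m}"

definition trapezoidal_sum :: complex where
  "trapezoidal_sum = h * (\<Sum>k\<in>{- int m..int m}. g (of_real (real_of_int k * h)))"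

abbreviation kernel_integrand :: "complex \<Rightarrow> complex" where
  "kernel_integrand \<equiv> \<lambda>z. g z * grid_kernel h z"

abbreviation horizontal :: "real \<Rightarrow> real \<Rightarrow> complex" where
  "horizontal t \<equiv> linepath (Complex (- half_width) t) (Complex half_width t)"

abbreviation horizontal_segment :: "real \<Rightarrow> complex set" where
  "horizontal_segment t \<equiv> closed_segment (Complex (- half_width) t) (Complex half_width t)"

abbreviation vertical :: "real \<Rightarrow> real \<Rightarrow> real \<Rightarrow> complex" where
  "vertical x t \<equiv> linepath (Complex x (- y)) (Complex x t)"

abbreviation vertical_segment :: "real \<Rightarrow> real \<Rightarrow> complex set" where
  "vertical_segment x t \<equiv> closed_segment (Complex x (- y)) (Complex x t)"

abbreviation rectangle :: "real \<Rightarrow> real \<Rightarrow> complex" where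
  "rectangle t \<equiv> rectpath (Complex (- half_width) (- y)) (Complex half_width t)"

lemma half_width_pos: "0 < half_width"
  using h by (simp add: half_width_def)

lemma continuous_on_g: "A \<subseteq> strip d \<Longrightarrow> continuous_on A g"
  using holomorphic_on_imp_continuous_on[OF holo] continuous_on_subset by blast

lemma continuous_on_kernel_integrand:
  assumes "A \<subseteq> strip d" "\<And>z. z \<in> A \<Longrightarrow> grid_exp h z \<noteq> 1"
  shows "continuous_on A kernel_integrand"
  unfolding grid_kernel_def using assms
  by (intro continuous_intros continuous_on_g
      holomorphic_on_imp_continuous_on[OF holomorphic_grid_exp]) auto

lemma vertical_midpoint:
  assumes "\<bar>x\<bar> = half_width"
  obtains k :: int where "x = (of_int k + 1 / 2) * h"
proof -
  have "x = (of_int (int m) + 1 / 2) * h \<or> x = (of_int (- int m - 1) + 1 / 2) * h"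
    using assms by (auto simp: half_width_def abs_if algebra_simps split: if_splits)
  then show ?thesis using that by blast
qed

lemma norm_grid_kernel_vertical_le:
  assumes "\<bar>x\<bar> = half_width"
  shows "norm (grid_kernel h (Complex x t)) \<le> 1"
proof -
  obtain k :: int where "x = (of_int k + 1 / 2) * h" using vertical_midpoint[OF assms] .
  then show ?thesis using norm_grid_kernel_le_midpoint[OF h] by simp
qed

lemma grid_exp_neq_1_vertical:
  assumes "\<bar>Re z\<bar> = half_width"
  shows "grid_exp h z \<noteq> 1"
proof -
  obtain k :: int where "Re z = (of_int k + 1 / 2) * h" using vertical_midpoint[OF assms] .
  then have "grid_exp h z = - of_real (exp (2 * pi * Im z / h))"
    using grid_exp_midpoint[OF h] by (metis complex_surj)
  then have "Re (grid_exp h z) < 0" by (simp add: exp_of_real)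
  then show ?thesis by auto
qed

lemma horizontal_segment_eq: "horizontal_segment t = {z. Im z = t \<and> \<bar>Re z\<bar> \<le> half_width}"
  using half_width_pos by (auto simp: closed_segment_same_Im closed_segment_eq_real_ivl)

lemma vertical_segment_eq:
  "- y \<le> t \<Longrightarrow> vertical_segment x t = {z. Re z = x \<and> - y \<le> Im z \<and> Im z \<le> t}"
  by (auto simp: closed_segment_same_Re closed_segment_eq_real_ivl)

lemma continuous_on_horizontal:
  assumes "\<bar>t\<bar> \<le> y"
  shows "continuous_on (horizontal_segment t) g"
    and "t \<noteq> 0 \<Longrightarrow> continuous_on (horizontal_segment t) kernel_integrand"
proof -
  have sub: "horizontal_segment t \<subseteq> strip d"
    using assms y by (auto simp: horizontal_segment_eq strip_def)
  show "continuous_on (horizontal_segment t) g"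
    using sub by (rule continuous_on_g)
  show "continuous_on (horizontal_segment t) kernel_integrand" if "t \<noteq> 0"
    using sub that
    by (intro continuous_on_kernel_integrand grid_exp_neq_1[OF h])
      (auto simp: horizontal_segment_eq)
qed

lemma continuous_on_vertical:
  assumes "\<bar>x\<bar> = half_width" "- y \<le> t" "t \<le> y"
  shows "continuous_on (vertical_segment x t) g"
    and "continuous_on (vertical_segment x t) kernel_integrand"
proof -
  have sub: "vertical_segment x t \<subseteq> strip d"
    using assms y by (auto simp: vertical_segment_eq strip_def)
  show "continuous_on (vertical_segment x t) g"
    using sub by (rule continuous_on_g)
  show "continuous_on (vertical_segment x t) kernel_integrand"
    using sub assms
    by (intro continuous_on_kernel_integrand grid_exp_neq_1_vertical)
      (auto simp: vertical_segment_eq)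
qed

lemma grid_subset_box: "grid \<subseteq> box (Complex (- half_width) (- y)) (Complex half_width y)"
proof
  fix z assume "z \<in> grid"
  then obtain k where k: "k \<in> {- int m..int m}" "z = of_real (real_of_int k * h)"
    by (auto simp: grid_def)
  have "\<bar>real_of_int k\<bar> < real m + 1 / 2" using k(1) by auto
  then have "\<bar>real_of_int k * h\<bar> < half_width" using h by (simp add: abs_mult half_width_def)
  then show "z \<in> box (Complex (- half_width) (- y)) (Complex half_width y)"
    using y k(2) by (auto simp: in_box_complex_iff abs_less_iff)
qed

lemma grid_exp_eq_1_imp_grid:
  assumes "grid_exp h z = 1" "\<bar>Re z\<bar> < (real m + 1) * h"
  shows "z \<in> grid"
proof -
  obtain k :: int where k: "z = of_real (of_int k * h)"
    using grid_exp_eq_1_iff[OF h] assms(1) by blast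
  then have "\<bar>real_of_int k\<bar> * h < (real m + 1) * h" using assms(2) h by (simp add: abs_mult)
  then have "\<bar>real_of_int k\<bar> < real m + 1" by (simp only: mult_less_cancel_right_pos[OF h])
  then have "k \<in> {- int m..int m}" by auto
  then show ?thesis using k by (auto simp: grid_def)
qed

lemma residue_kernel_integrand:
  assumes "p \<in> grid"
  shows "residue kernel_integrand p = g p * h / (2 * pi * \<i>)"
proof -
  obtain k :: int where k: "p = of_real (real_of_int k * h)" using assms by (auto simp: grid_def)
  have "of_real (real_of_int k * h) \<in> strip d" using y by (simp add: strip_def)
  then show ?thesis unfolding k by (intro residue_grid_kernel[OF h open_strip _ holo])
qed

lemma contour_integral_rectangle_residues:
  "contour_integral (rectangle y) kernel_integrand
     = 2 * pi * \<i> * (\<Sum>p\<in>grid. winding_number (rectangle y) p * residue kernel_integrand p)"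
proof -
  define S where "S = box (Complex (- ((real m + 1) * h)) (- d)) (Complex ((real m + 1) * h) d)"
  have S: "z \<in> S \<longleftrightarrow> \<bar>Re z\<bar> < (real m + 1) * h \<and> z \<in> strip d" for z
    by (auto simp: S_def in_box_complex_iff strip_def)
  have "half_width < (real m + 1) * h" using h by (simp add: half_width_def)
  then have cbox: "cbox (Complex (- half_width) (- y)) (Complex half_width y) \<subseteq> S"
    using y by (auto simp: S in_cbox_complex_iff strip_def)
  show ?thesis
  proof (rule Residue_theorem[of S])
    show "open S" "connected S"
      by (auto simp: S_def intro: open_box convex_connected convex_box)
    show "finite grid" by (simp add: grid_def)
    show "kernel_integrand holomorphic_on S - grid"
    proof -
      have "grid_exp h z \<noteq> 1" if "z \<in> S - grid" for z
        using that grid_exp_eq_1_imp_grid by (auto simp: S)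
      moreover have "g holomorphic_on S - grid"
        by (rule holomorphic_on_subset[OF holo]) (auto simp: S)
      ultimately show ?thesis unfolding grid_kernel_def
        by (intro holomorphic_intros holomorphic_grid_exp) auto
    qed
    show "path_image (rectangle y) \<subseteq> S - grid"
      using path_image_rectpath_cbox_minus_box
          [of "Complex (- half_width) (- y)" "Complex half_width y"]
        half_width_pos y grid_subset_box cbox by auto
    show "\<forall>z. z \<notin> S \<longrightarrow> winding_number (rectangle y) z = 0"
    proof (intro allI impI)
      fix z assume "z \<notin> S"
      then show "winding_number (rectangle y) z = 0"
        using cbox half_width_pos y by (intro winding_number_rectpath_outside) auto
    qed
  qed auto
qed

lemma contour_integral_rectangle_kernel_integrand:
  "contour_integral (rectangle y) kernel_integrand = trapezoidal_sum"
proof -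
  have "winding_number (rectangle y) p = 1" if "p \<in> grid" for p
    using grid_subset_box that by (intro winding_number_rectpath) auto
  then have "(\<Sum>p\<in>grid. winding_number (rectangle y) p * residue kernel_integrand p)
      = (\<Sum>p\<in>grid. g p * h / (2 * pi * \<i>))"
    by (intro sum.cong) (simp_all add: residue_kernel_integrand)
  also have "\<dots> = (\<Sum>k\<in>{- int m..int m}. g (of_real (real_of_int k * h)) * h / (2 * pi * \<i>))"
    unfolding grid_def using h by (subst sum.reindex) (auto simp: inj_on_def)
  finally show ?thesis
    unfolding contour_integral_rectangle_residues
    by (simp add: trapezoidal_sum_def sum_distrib_left mult_ac)
qed

lemma trapezoidal_sum_eq_contour_integral:
  "trapezoidal_sum = contour_integral (horizontal (- y)) kernel_integrand
     + contour_integral (vertical half_width y) kernel_integrand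
     - contour_integral (horizontal y) kernel_integrand
     - contour_integral (vertical (- half_width) y) kernel_integrand"
proof -
  have "continuous_on (path_image (rectangle y)) kernel_integrand"
  proof (rule continuous_on_kernel_integrand)
    show "path_image (rectangle y) \<subseteq> strip d"
      using half_width_pos y by (auto simp: path_image_rectpath strip_def)
    fix z assume "z \<in> path_image (rectangle y)"
    then have "\<bar>Re z\<bar> = half_width \<or> Im z \<noteq> 0"
      using half_width_pos y by (auto simp: path_image_rectpath)
    then show "grid_exp h z \<noteq> 1" using grid_exp_neq_1_vertical grid_exp_neq_1[OF h] by blast
  qed
  from contour_integral_rectpath[OF this] show ?thesis
    by (simp add: contour_integral_rectangle_kernel_integrand)
qed

lemma integral_real_axis_eq_contour_integral:
  "integral {- half_width..half_width} (\<lambda>x. g (of_real x))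
     = contour_integral (horizontal (- y)) g
       + contour_integral (vertical half_width 0) g
       - contour_integral (vertical (- half_width) 0) g"
proof -
  have "integral {- half_width..half_width} (\<lambda>x. g (of_real x)) = contour_integral (horizontal 0) g"
    using has_integral_linepath_same_Im[of "- half_width" half_width 0 g]
      continuous_on_horizontal(1)[of 0] half_width_pos y
    by (simp add: integral_unique complex_of_real_def)
  moreover have in_strip: "path_image (rectangle 0) \<subseteq> strip d"
    using half_width_pos y by (auto simp: path_image_rectpath strip_def)
  then have "contour_integral (rectangle 0) g = 0"
    by (intro contour_integral_unique Cauchy_theorem_convex_simple[OF holo convex_strip]) auto
  ultimately show ?thesis
    using contour_integral_rectpath[OF continuous_on_g[OF in_strip]] by (simp add: algebra_simps)
qed

text \<open>The kernel is close to 1 below the real axis and close to 0 above it. Cauchy's theorem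
  therefore replaces the lower horizontal integral by the integral along the real axis.\<close>

lemma trapezoidal_error_eq_contour_integral:
  "integral {- half_width..half_width} (\<lambda>x. g (of_real x)) - trapezoidal_sum
     = contour_integral (horizontal y) kernel_integrand
       - contour_integral (horizontal (- y)) (\<lambda>z. g z * (grid_kernel h z - 1))
       + (contour_integral (vertical half_width 0) g
          - contour_integral (vertical half_width y) kernel_integrand)
       - (contour_integral (vertical (- half_width) 0) g
          - contour_integral (vertical (- half_width) y) kernel_integrand)"
proof -
  have "contour_integral (horizontal (- y)) (\<lambda>z. kernel_integrand z - g z)
      = contour_integral (horizontal (- y)) kernel_integrand
        - contour_integral (horizontal (- y)) g"
    using y
    by (intro contour_integral_diff contour_integrable_continuous_linepath
        continuous_on_horizontal) auto
  then show ?thesis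
    unfolding integral_real_axis_eq_contour_integral trapezoidal_sum_eq_contour_integral
    by (simp add: algebra_simps)
qed

context
  fixes B :: "real \<Rightarrow> real"
  assumes B: "\<And>x t. \<bar>t\<bar> \<le> y \<Longrightarrow> norm (g (Complex x t)) \<le> B x"
    and B_integrable: "B integrable_on {- half_width..half_width}"
begin

lemma B_nonneg: "0 \<le> B x"
  using order_trans[OF norm_ge_zero B[of 0 x]] y by simp

lemma norm_horizontal_integral_le:
  assumes t: "\<bar>t\<bar> = y" and cont: "continuous_on (horizontal_segment t) (\<lambda>z. g z * \<kappa> z)"
    and \<kappa>: "\<And>x. norm (\<kappa> (Complex x t)) \<le> 1 / (exp (2 * pi * y / h) - 1)"
  shows "norm (contour_integral (horizontal t) (\<lambda>z. g z * \<kappa> z))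
    \<le> integral {- half_width..half_width} B / (exp (2 * pi * y / h) - 1)"
proof -
  let ?B = "\<lambda>x. B x * (1 / (exp (2 * pi * y / h) - 1))"
  have "norm (contour_integral (horizontal t) (\<lambda>z. g z * \<kappa> z))
      \<le> integral {- half_width..half_width} ?B"
  proof (rule norm_contour_integral_same_Im_le[OF _ cont])
    show "norm (g (Complex x t) * \<kappa> (Complex x t)) \<le> ?B x" for x
      unfolding norm_mult using B[of t x] t \<kappa> B_nonneg by (intro mult_mono) auto
    show "?B integrable_on {- half_width..half_width}"
      using B_integrable by (rule integrable_on_mult_left)
  qed (use half_width_pos in auto)
  then show ?thesis by simp
qed

lemma norm_vertical_integral_diff_le:
  assumes x: "\<bar>x\<bar> = half_width"
  shows "norm (contour_integral (vertical x 0) g - contour_integral (vertical x y) kernel_integrand)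
    \<le> 3 * y * B x"
proof -
  have "norm (contour_integral (vertical x 0) g) \<le> B x * (0 - - y)"
    using x y by (intro norm_contour_integral_same_Re_le continuous_on_vertical B) auto
  moreover have "norm (contour_integral (vertical x y) kernel_integrand) \<le> B x * (y - - y)"
  proof (intro norm_contour_integral_same_Re_le continuous_on_vertical)
    fix t assume "- y \<le> t" "t \<le> y"
    then have "norm (g (Complex x t)) * norm (grid_kernel h (Complex x t)) \<le> B x * 1"
      using x B_nonneg by (intro mult_mono B norm_grid_kernel_vertical_le) auto
    then show "norm (kernel_integrand (Complex x t)) \<le> B x" by (simp only: norm_mult mult_1_right)
  qed (use x y in auto)
  ultimately show ?thesis
    by (intro order_trans[OF norm_triangle_ineq4]) (simp add: algebra_simps)
qed

lemma trapezoidal_error_le: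
  "norm (integral {- half_width..half_width} (\<lambda>x. g (of_real x)) - trapezoidal_sum)
     \<le> 2 * integral {- half_width..half_width} B / (exp (2 * pi * y / h) - 1)
       + 3 * y * (B half_width + B (- half_width))"
proof -
  let ?q = "integral {- half_width..half_width} B / (exp (2 * pi * y / h) - 1)"
  have "norm (contour_integral (horizontal y) kernel_integrand) \<le> ?q"
    using norm_grid_kernel_le_above[OF h, of "Complex _ y"] y
    by (intro norm_horizontal_integral_le continuous_on_horizontal) auto
  moreover
  have "norm (contour_integral (horizontal (- y)) (\<lambda>z. g z * (grid_kernel h z - 1))) \<le> ?q"
  proof (rule norm_horizontal_integral_le)
    show "continuous_on (horizontal_segment (- y)) (\<lambda>z. g z * (grid_kernel h z - 1))"
      unfolding right_diff_distrib mult_1_right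
      using y by (intro continuous_on_diff continuous_on_horizontal) auto
    show "norm (grid_kernel h (Complex x (- y)) - 1) \<le> 1 / (exp (2 * pi * y / h) - 1)" for x
      using norm_grid_kernel_minus_1_le_below[OF h, of "Complex x (- y)"] y by simp
  qed (use y in auto)
  ultimately have "norm (integral {- half_width..half_width} (\<lambda>x. g (of_real x)) - trapezoidal_sum)
      \<le> ?q + ?q + 3 * y * B half_width + 3 * y * B (- half_width)"
    unfolding trapezoidal_error_eq_contour_integral using half_width_pos
    by (intro order_trans[OF norm_triangle_ineq4] order_trans[OF norm_triangle_ineq]
        add_mono norm_vertical_integral_diff_le) auto
  then show ?thesis by (simp add: distrib_left)
qed

end

end

section \<open>Improper integrals\<close>

lemma power2_powr_half: "0 \<le> x \<Longrightarrow> (x\<^sup>2) powr (e / 2) = x powr e" for x :: real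
  by (cases "x = 0") (simp_all add: powr_def ln_realpow)

lemma integral_symmetric_interval_tendsto:
  fixes F :: "real \<Rightarrow> 'a :: banach"
  assumes "F integrable_on UNIV" and r: "filterlim r at_top G"
  shows "((\<lambda>m. integral {- r m..r m} F) \<longlongrightarrow> integral UNIV F) G"
proof (rule tendstoI)
  fix e :: real assume "0 < e"
  have "(F has_integral integral UNIV F) UNIV" using assms(1) by (rule integrable_integral)
  then obtain B
    where B: "\<And>a b. ball 0 B \<subseteq> cbox a b \<Longrightarrow> norm (integral (cbox a b) F - integral UNIV F) < e"
    using \<open>0 < e\<close> unfolding has_integral_alt' by (simp only: UNIV_I if_True) blast
  have "eventually (\<lambda>m. B \<le> r m) G" using r by (simp add: filterlim_at_top)
  then show "eventually (\<lambda>m. dist (integral {- r m..r m} F) (integral UNIV F) < e) G"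
  proof eventually_elim
    fix m assume "B \<le> r m"
    then have "ball 0 B \<subseteq> cbox (- r m) (r m)" by (auto simp: dist_real_def)
    then show "dist (integral {- r m..r m} F) (integral UNIV F) < e"
      using B by (simp add: dist_norm)
  qed
qed

lemma abs_powr_integrable_on_outside_unit:
  assumes "0 < \<mu>"
  shows "(\<lambda>t. \<bar>t\<bar> powr (- (\<mu> + 1))) integrable_on {1 :: real..}"
    and "(\<lambda>t. \<bar>t\<bar> powr (- (\<mu> + 1))) integrable_on {..-1 :: real}"
proof -
  let ?G = "\<lambda>t :: real. \<bar>t\<bar> powr (- (\<mu> + 1))"
  have "(\<lambda>t. t powr (- (\<mu> + 1))) integrable_on {1 :: real..}"
    using has_integral_powr_to_inf[of "- (\<mu> + 1)" 1] assms by (auto simp: integrable_on_def)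
  then show right: "?G integrable_on {1..}" by (rule integrable_eq) simp
  then have "?G absolutely_integrable_on {1..}"
    by (intro nonnegative_absolutely_integrable_1) auto
  then show "?G integrable_on {..-1}"
    using has_absolute_integral_reflect_real[of "{1..}" "{..-1}" ?G "integral {1..} ?G"]
    by (auto simp: absolutely_integrable_on_def)
qed

lemma integrable_on_UNIV_polynomial_decay:
  fixes F :: "real \<Rightarrow> 'a :: euclidean_space"
  assumes cont: "continuous_on UNIV F" and "0 \<le> K" and \<mu>: "0 < \<mu>"
    and bound: "\<And>t. norm (F t) \<le> K * (1 + t\<^sup>2) powr (- (\<mu> + 1) / 2)"
  shows "F integrable_on UNIV"
proof -
  define G where "G = (\<lambda>t :: real. K * \<bar>t\<bar> powr (- (\<mu> + 1)))"
  have G: "norm (F t) \<le> G t" if "t \<noteq> 0" for t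
  proof -
    have "norm (F t) \<le> K * (1 + t\<^sup>2) powr (- (\<mu> + 1) / 2)" by (rule bound)
    also have "\<dots> \<le> K * (\<bar>t\<bar>\<^sup>2) powr (- (\<mu> + 1) / 2)"
      using that \<mu> \<open>0 \<le> K\<close> by (intro mult_left_mono powr_mono2') auto
    also have "(\<bar>t\<bar>\<^sup>2) powr (- (\<mu> + 1) / 2) = \<bar>t\<bar> powr (- (\<mu> + 1))"
      by (rule power2_powr_half) simp
    finally show ?thesis by (simp add: G_def)
  qed
  have outside: "F integrable_on A" if "G integrable_on A" "A \<in> sets lebesgue" "0 \<notin> A" for A
  proof (rule measurable_bounded_by_integrable_imp_integrable[OF _ that(1)])
    show "F \<in> borel_measurable (lebesgue_on A)"
      by (intro continuous_imp_measurable_on_sets_lebesgue continuous_on_subset[OF cont] that) auto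
    show "norm (F t) \<le> G t" if "t \<in> A" for t
      using G that \<open>0 \<notin> A\<close> by metis
  qed (rule that)
  have left: "F integrable_on {..-1}" and right: "F integrable_on {1..}"
    unfolding G_def using abs_powr_integrable_on_outside_unit[OF \<mu>]
    by (auto intro!: outside integrable_on_mult_right simp: G_def)
  have mid: "F integrable_on {-1..1}"
    by (intro integrable_continuous_real continuous_on_subset[OF cont]) auto
  have "{..-1} \<inter> {-1..1} = {-1 :: real}" "({..-1} \<union> {-1..1}) \<inter> {1..} = {1 :: real}" by auto
  then have "F integrable_on (({..-1} \<union> {-1..1}) \<union> {1..})"
    using integrable_Un[OF _ integrable_Un[OF _ left mid] right] by simp
  moreover have "({..-1} \<union> {-1..1}) \<union> {1..} = (UNIV :: real set)" by auto
  ultimately show ?thesis by simp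
qed

section \<open>The transformed integrand\<close>

definition de_integrand :: "(complex \<Rightarrow> complex) \<Rightarrow> complex \<Rightarrow> complex" where
  "de_integrand f z = f (psi z) * deriv psi z"

definition de_sum :: "(complex \<Rightarrow> complex) \<Rightarrow> real \<Rightarrow> int set \<Rightarrow> complex" where
  "de_sum f h A = of_real h * (\<Sum>k\<in>A. de_integrand f (of_real (real_of_int k * h)))"

definition de_rate :: "real \<Rightarrow> real \<Rightarrow> real" where
  "de_rate \<gamma> y = \<gamma> * pi / 2 * cos y"

definition de_const :: "real \<Rightarrow> real \<Rightarrow> real \<Rightarrow> real" where
  "de_const K \<gamma> y = K * 2 powr \<gamma> / (\<gamma> * cos y * cos (pi / 2 * sin y) powr \<gamma>)"

lemma of_real_sinh: "of_real (sinh x) = (sinh (of_real x) :: complex)"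
  and of_real_cosh: "of_real (cosh x) = (cosh (of_real x) :: complex)"
  by (simp_all add: sinh_field_def cosh_field_def exp_minus exp_of_real)

lemma DERIV_psi:
  "(psi has_field_derivative of_real (pi / 2) * cosh z * cosh (of_real (pi / 2) * sinh z)) (at z)"
  unfolding psi_def[abs_def] by (auto intro!: derivative_eq_intros)

lemma deriv_psi: "deriv psi z = of_real (pi / 2) * cosh z * cosh (of_real (pi / 2) * sinh z)"
  using DERIV_psi by (rule DERIV_imp_deriv)

lemma one_plus_psi_sq: "1 + (psi z)\<^sup>2 = (cosh (of_real (pi / 2) * sinh z))\<^sup>2"
  by (simp add: psi_def cosh_square_eq)

lemma psi_of_real: "psi (of_real x) = of_real (sinh (pi / 2 * sinh x))"
  by (simp add: psi_def of_real_sinh)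

lemma deriv_psi_of_real:
  "deriv psi (of_real x) = of_real (pi / 2 * cosh x * cosh (pi / 2 * sinh x))"
  by (simp add: deriv_psi of_real_sinh of_real_cosh)

lemma psi_holomorphic: "psi holomorphic_on UNIV"
  using DERIV_psi
  by (auto simp: holomorphic_on_def field_differentiable_def intro: has_field_derivative_at_within)

lemma of_real_in_psi_strip:
  fixes t :: real
  assumes "0 < d"
  obtains x where "of_real t = psi (of_real x)" "of_real x \<in> strip d"
proof
  define x where "x = arsinh (2 / pi * arsinh t)"
  show "of_real t = psi (of_real x)" by (simp add: psi_of_real x_def)
  show "of_real x \<in> strip d" using assms by (simp add: strip_def)
qed

lemma holomorphic_de_integrand:
  assumes "f analytic_on (psi ` strip d)"
  shows "de_integrand f holomorphic_on strip d"
proof -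
  have "psi analytic_on strip d"
    using psi_holomorphic analytic_on_subset[of psi UNIV] by (simp add: analytic_on_open)
  then have "(f \<circ> psi) holomorphic_on strip d"
    using assms by (intro analytic_imp_holomorphic analytic_on_compose)
  moreover have "deriv psi holomorphic_on strip d"
    using holomorphic_deriv[OF psi_holomorphic] holomorphic_on_subset by blast
  ultimately show ?thesis unfolding de_integrand_def[abs_def] o_def by (rule holomorphic_on_mult)
qed

lemma integral_de_integrand:
  assumes cont: "continuous_on UNIV (\<lambda>t::real. f (complex_of_real t))" and "0 \<le> R"
  shows "integral {-R..R} (\<lambda>x. de_integrand f (of_real x))
           = integral {- sinh (pi / 2 * sinh R)..sinh (pi / 2 * sinh R)} (\<lambda>t. f (of_real t))"
proof -
  define p where "p = (\<lambda>x::real. sinh (pi / 2 * sinh x))"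
  define p' where "p' = (\<lambda>x::real. pi / 2 * cosh x * cosh (pi / 2 * sinh x))"
  have dp: "(p has_real_derivative p' x) (at x within A)" for x A
    unfolding p_def p'_def by (auto intro!: derivative_eq_intros)
  have mono: "p x \<le> p x'" if "x \<le> x'" for x x' using that by (simp add: p_def)
  have "((\<lambda>x. p' x *\<^sub>R f (of_real (p x))) has_integral
      integral {p (-R)..p R} (\<lambda>t. f (of_real t))) {-R..R}"
    using assms(2) dp mono
    by (intro has_integral_substitution[where c = "p (-R)" and d = "p R"]
        continuous_on_subset[OF cont]) auto
  moreover have "p' x *\<^sub>R f (of_real (p x)) = de_integrand f (of_real x)" for x
    unfolding de_integrand_def psi_of_real deriv_psi_of_real p_def p'_def
    by (simp add: scaleR_conv_of_real)
  ultimately show ?thesis by (simp add: integral_unique p_def)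
qed

lemma cos_half_pi_sin_pos:
  fixes y :: real
  assumes "\<bar>y\<bar> < pi / 2"
  shows "0 < cos (pi / 2 * sin y)"
proof (rule cos_gt_zero_pi)
  have "sin y < 1" "- 1 < sin y"
    using assms sin_monotone_2pi[of y "pi / 2"] sin_monotone_2pi[of "- (pi / 2)" y]
    by (simp_all add: abs_less_iff)
  then show "pi / 2 * sin y < pi / 2" "- (pi / 2) < pi / 2 * sin y"
    using mult_strict_left_mono[of "- 1" "sin y" "pi / 2"] by simp_all
qed

lemma cos_half_pi_sin_antimono:
  fixes t y :: real
  assumes "\<bar>t\<bar> \<le> y" "y < pi / 2"
  shows "cos (pi / 2 * sin y) \<le> cos (pi / 2 * sin t)"
proof -
  have "0 \<le> sin \<bar>t\<bar>" using assms by (intro sin_ge_zero) auto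
  moreover have "sin \<bar>t\<bar> \<le> sin y" using assms by (intro sin_monotone_2pi_le) auto
  moreover have "pi / 2 * sin y \<le> pi"
    using mult_left_mono[OF sin_le_one[of y], of "pi / 2"] pi_gt_zero by linarith
  ultimately have "cos (pi / 2 * sin y) \<le> cos (pi / 2 * sin \<bar>t\<bar>)"
    by (intro cos_monotone_0_pi_le) auto
  then show ?thesis by (cases "0 \<le> t") auto
qed

lemma de_const_nonneg:
  assumes "0 \<le> K" "0 < \<gamma>" "0 \<le> y" "y < pi / 2"
  shows "0 \<le> de_const K \<gamma> y"
  unfolding de_const_def using assms cos_gt_zero_pi[of y]
  by (intro divide_nonneg_nonneg mult_nonneg_nonneg) auto

lemma de_const_mono:
  assumes K: "0 \<le> K" and "0 < \<mu>" "\<mu> \<le> \<gamma>" "\<gamma> \<le> \<nu>" and y: "0 \<le> y" "y < pi / 2"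
  shows "de_const K \<gamma> y \<le> K * 2 powr \<nu> / (\<mu> * cos y * cos (pi / 2 * sin y) powr \<nu>)"
  unfolding de_const_def
proof (rule frac_le)
  have cosy: "0 < cos y" and c: "0 < cos (pi / 2 * sin y)"
    using cos_gt_zero_pi[of y] cos_half_pi_sin_pos[of y] y by auto
  show "0 < \<mu> * cos y * cos (pi / 2 * sin y) powr \<nu>" using assms cosy c by simp
  show "\<mu> * cos y * cos (pi / 2 * sin y) powr \<nu> \<le> \<gamma> * cos y * cos (pi / 2 * sin y) powr \<gamma>"
    using assms cosy c by (intro mult_mono powr_mono') auto
  show "K * 2 powr \<gamma> \<le> K * 2 powr \<nu>" using assms by (intro mult_left_mono powr_mono) auto
qed (use K in auto)

lemma norm_cosh_half_pi_sinh_ge_exp: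
  fixes z :: complex
  assumes "\<bar>Im z\<bar> \<le> y" "y < pi / 2"
  shows "exp (pi / 2 * (sinh \<bar>Re z\<bar> * cos y)) / 2 * cos (pi / 2 * sin y)
           \<le> norm (cosh (of_real (pi / 2) * sinh z))"
proof -
  let ?a = "pi / 2 * (sinh \<bar>Re z\<bar> * cos y)"
  have "0 < cos y" using assms by (intro cos_gt_zero_pi) auto
  have "cos y \<le> cos \<bar>Im z\<bar>" using assms by (intro cos_monotone_0_pi_le) auto
  then have cos_le: "cos y \<le> cos (Im z)" by simp
  have "exp ?a / 2 \<le> cosh ?a" by (simp add: cosh_field_def)
  also have "\<dots> \<le> cosh (pi / 2 * (sinh \<bar>Re z\<bar> * cos (Im z)))"
    using cos_le \<open>0 < cos y\<close>
    by (subst cosh_real_nonneg_le_iff) (auto intro!: mult_nonneg_nonneg mult_left_mono)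
  also have "\<dots> = cosh (pi / 2 * (sinh (Re z) * cos (Im z)))" by (cases "0 \<le> Re z") auto
  finally have "exp ?a / 2 * cos (pi / 2 * sin y)
      \<le> cosh (pi / 2 * (sinh (Re z) * cos (Im z))) * cos (pi / 2 * sin (Im z))"
    using cos_half_pi_sin_antimono[OF assms] cos_half_pi_sin_pos[of y] assms
    by (intro mult_mono) (auto simp: abs_less_iff)
  also have "\<dots> \<le> norm (cosh (of_real (pi / 2) * sinh z))"
    using assms by (intro norm_cosh_half_pi_sinh_ge) auto
  finally show ?thesis .
qed

lemma norm_de_integrand_le:
  assumes y: "\<bar>Im z\<bar> \<le> y" "y < pi / 2" and K: "0 \<le> K" and \<gamma>: "0 < \<gamma>"
    and bound: "norm (f (psi z)) \<le> K * norm (1 + (psi z)\<^sup>2) powr (- (\<gamma> + 1) / 2)"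
  shows "norm (de_integrand f z) \<le> de_const K \<gamma> y * de_weight (de_rate \<gamma> y) \<bar>Re z\<bar>"
proof -
  define W where "W = norm (cosh (of_real (pi / 2) * sinh z))"
  define a where "a = pi / 2 * (sinh \<bar>Re z\<bar> * cos y)"
  define c where "c = cos (pi / 2 * sin y)"
  have cosy: "0 < cos y" and c: "0 < c"
    unfolding c_def using cos_gt_zero_pi[of y] cos_half_pi_sin_pos[of y] y by auto
  have W_ge: "exp a / 2 * c \<le> W"
    unfolding a_def c_def W_def using y by (rule norm_cosh_half_pi_sinh_ge_exp)
  have W: "0 < W" using W_ge c by (intro less_le_trans[OF _ W_ge]) simp
  have "norm (f (psi z)) \<le> K * (W\<^sup>2) powr (- (\<gamma> + 1) / 2)"
    using bound unfolding one_plus_psi_sq W_def by (simp add: norm_power)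
  also have "(W\<^sup>2) powr (- (\<gamma> + 1) / 2) = W powr (- (\<gamma> + 1))"
    using W by (intro power2_powr_half) simp
  finally have f: "norm (f (psi z)) \<le> K * W powr (- (\<gamma> + 1))" .
  have "norm (de_integrand f z) = norm (f (psi z)) * (pi / 2 * norm (cosh z) * W)"
    by (simp add: de_integrand_def deriv_psi W_def norm_mult)
  also have "\<dots> \<le> K * W powr (- (\<gamma> + 1)) * (pi / 2 * cosh (Re z) * W)"
    using f W K norm_cosh_le[of z] by (intro mult_mono) auto
  also have "\<dots> = K * (pi / 2) * cosh (Re z) * (W powr (- (\<gamma> + 1)) * W)" by simp
  also have "W powr (- (\<gamma> + 1)) * W = W powr (- \<gamma>)"
    using W by (simp add: powr_mult_base' powr_add powr_diff powr_minus field_simps)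
  also have "K * (pi / 2) * cosh (Re z) * W powr (- \<gamma>)
      \<le> K * (pi / 2) * cosh (Re z) * (exp a / 2 * c) powr (- \<gamma>)"
    using W_ge c K \<gamma> by (intro mult_left_mono powr_mono2') auto
  also have "(exp a / 2 * c) powr (- \<gamma>) = exp (- (\<gamma> * a)) * 2 powr \<gamma> / c powr \<gamma>"
    using c by (simp add: powr_mult powr_divide powr_minus exp_powr_real exp_minus field_simps)
  also have "K * (pi / 2) * cosh (Re z) * (exp (- (\<gamma> * a)) * 2 powr \<gamma> / c powr \<gamma>)
      = de_const K \<gamma> y * de_weight (de_rate \<gamma> y) \<bar>Re z\<bar>"
    using \<gamma> cosy
    by (cases "0 \<le> Re z") (simp_all add: de_const_def de_rate_def de_weight_def a_def c_def mult_ac)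
  finally show ?thesis .
qed

section \<open>Discretization and truncation\<close>

lemma has_integral_de_weight:
  assumes "0 \<le> R"
  shows "(de_weight a has_integral 1 - exp (- (a * sinh R))) {0..R}"
proof -
  have "(de_weight a has_integral (- exp (- (a * sinh R)) - - exp (- (a * sinh 0)))) {0..R}"
    using assms DERIV_neg_exp_neg_sinh[of a]
    by (intro fundamental_theorem_of_calculus)
      (auto simp flip: has_real_derivative_iff_has_vector_derivative)
  then show ?thesis by simp
qed

lemma norm_sum_int_tail_le:
  fixes F :: "int \<Rightarrow> 'a :: real_normed_vector"
  assumes h: "0 < h" and c: "0 \<le> c"
    and F: "\<And>k. N < k \<Longrightarrow> norm (F k) \<le> c * de_weight a (real_of_int k * h)"
    and tail: "\<And>l. de_tail a h (real_of_int N * h) l \<le> \<tau>"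
  shows "h * norm (\<Sum>k\<in>{N<..m}. F k) \<le> c * \<tau>"
proof -
  have "norm (\<Sum>k\<in>{N<..m}. F k) \<le> (\<Sum>k\<in>{N<..m}. c * de_weight a (real_of_int k * h))"
    by (intro sum_norm_le F) auto
  also have "\<dots> = (\<Sum>j<nat (m - N). c * de_weight a (real_of_int N * h + real (Suc j) * h))"
    by (rule sum.reindex_bij_witness[of _ "\<lambda>j. N + int (Suc j)" "\<lambda>k. nat (k - N - 1)"])
      (auto simp: algebra_simps)
  finally have "h * norm (\<Sum>k\<in>{N<..m}. F k) \<le> c * de_tail a h (real_of_int N * h) (nat (m - N))"
    using h by (simp add: de_tail_def mult.left_commute flip: sum_distrib_left)
  also have "\<dots> \<le> c * \<tau>" using c by (intro mult_left_mono tail)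
  finally show ?thesis .
qed

locale de_function =
  fixes f :: "complex \<Rightarrow> complex" and d K \<alpha> \<beta> :: real
  assumes d: "0 < d" "d < pi / 2" and f_analytic: "f analytic_on (psi ` strip d)"
    and K: "0 < K" and \<alpha>: "0 < \<alpha>" and \<beta>: "0 < \<beta>"
    and bound_minus: "\<And>z. z \<in> psi ` strip_minus d \<Longrightarrow>
      norm (f z) \<le> K * norm (1 + z\<^sup>2) powr (- (\<alpha> + 1) / 2)"
    and bound_plus: "\<And>z. z \<in> psi ` strip_plus d \<Longrightarrow>
      norm (f z) \<le> K * norm (1 + z\<^sup>2) powr (- (\<beta> + 1) / 2)"
begin

abbreviation quadrature_error :: "real \<Rightarrow> int \<Rightarrow> int \<Rightarrow> real" where
  "quadrature_error h M N \<equiv> norm (integral UNIV (\<lambda>t::real. f (of_real t)) - de_sum f h {- M..N})"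

definition discretization_bound :: "real \<Rightarrow> real \<Rightarrow> real" where
  "discretization_bound h y = 2 * (de_const K \<alpha> y + de_const K \<beta> y) / (exp (2 * pi * y / h) - 1)"

definition exponent :: "real \<Rightarrow> real" where
  "exponent x = (if x < 0 then \<alpha> else \<beta>)"

definition majorant :: "real \<Rightarrow> real \<Rightarrow> real" where
  "majorant y x = de_const K (exponent x) y * de_weight (de_rate (exponent x) y) \<bar>x\<bar>"

lemma exponent_pos: "0 < exponent x"
  using \<alpha> \<beta> by (simp add: exponent_def)

lemma norm_f_psi_le:
  assumes "z \<in> strip d"
  shows "norm (f (psi z)) \<le> K * norm (1 + (psi z)\<^sup>2) powr (- (exponent (Re z) + 1) / 2)"
  using assms bound_minus[of "psi z"] bound_plus[of "psi z"]
  by (auto simp: exponent_def strip_minus_def strip_plus_def)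

lemma norm_de_integrand_le_majorant:
  assumes "\<bar>Im z\<bar> \<le> y" "y < d"
  shows "norm (de_integrand f z) \<le> majorant y (Re z)"
  unfolding majorant_def using assms d K exponent_pos
  by (intro norm_de_integrand_le norm_f_psi_le) (auto simp: strip_def)

lemma de_rate_pos: "0 < \<gamma> \<Longrightarrow> 0 \<le> y \<Longrightarrow> y < d \<Longrightarrow> 0 < de_rate \<gamma> y"
  unfolding de_rate_def using d by (intro mult_pos_pos cos_gt_zero_pi) auto

lemma has_integral_majorant:
  assumes "0 \<le> R"
  shows "(majorant y has_integral de_const K \<alpha> y * (1 - exp (- (de_rate \<alpha> y * sinh R)))
           + de_const K \<beta> y * (1 - exp (- (de_rate \<beta> y * sinh R)))) {- R..R}"
proof (rule has_integral_combine[of "- R" 0 R])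
  have "((\<lambda>x. de_weight (de_rate \<alpha> y) (- x)) has_integral
      1 - exp (- (de_rate \<alpha> y * sinh R))) {- R..- 0}"
    by (subst has_integral_reflect_real) (rule has_integral_de_weight[OF assms])
  then have "((\<lambda>x. de_const K \<alpha> y * de_weight (de_rate \<alpha> y) (- x)) has_integral
      de_const K \<alpha> y * (1 - exp (- (de_rate \<alpha> y * sinh R)))) {- R..0}"
    by (intro has_integral_mult_right) simp
  then show "(majorant y has_integral
      de_const K \<alpha> y * (1 - exp (- (de_rate \<alpha> y * sinh R)))) {- R..0}"
    by (rule has_integral_spike_finite[of "{0}", rotated -1]) (auto simp: majorant_def exponent_def)
  have "((\<lambda>x. de_const K \<beta> y * de_weight (de_rate \<beta> y) x) has_integral
      de_const K \<beta> y * (1 - exp (- (de_rate \<beta> y * sinh R)))) {0..R}"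
    by (intro has_integral_mult_right has_integral_de_weight assms)
  then show "(majorant y has_integral
      de_const K \<beta> y * (1 - exp (- (de_rate \<beta> y * sinh R)))) {0..R}"
    by (rule has_integral_eq[rotated]) (auto simp: majorant_def exponent_def)
qed (use assms in auto)

lemma integral_majorant_le:
  assumes "0 \<le> R" "0 \<le> y" "y < d"
  shows "integral {- R..R} (majorant y) \<le> de_const K \<alpha> y + de_const K \<beta> y"
proof -
  have "integral {- R..R} (majorant y) \<le> de_const K \<alpha> y * 1 + de_const K \<beta> y * 1"
    unfolding integral_unique[OF has_integral_majorant[OF assms(1)]]
    using assms d K \<alpha> \<beta> by (intro add_mono mult_left_mono de_const_nonneg) auto
  then show ?thesis by simp
qed

lemma majorant_tendsto_0:
  assumes "0 \<le> y" "y < d"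
  shows "((\<lambda>x. majorant y x + majorant y (- x)) \<longlongrightarrow> 0) at_top"
proof (rule Lim_transform_eventually)
  show "((\<lambda>x. de_const K \<beta> y * de_weight (de_rate \<beta> y) x
      + de_const K \<alpha> y * de_weight (de_rate \<alpha> y) x) \<longlongrightarrow> 0) at_top"
    using assms \<alpha> \<beta> by (auto intro!: tendsto_eq_intros de_weight_tendsto_0 de_rate_pos)
  show "\<forall>\<^sub>F x in at_top. de_const K \<beta> y * de_weight (de_rate \<beta> y) x
      + de_const K \<alpha> y * de_weight (de_rate \<alpha> y) x = majorant y x + majorant y (- x)"
    using eventually_gt_at_top[of 0] by eventually_elim (simp add: majorant_def exponent_def)
qed

lemma discretization_error_le:
  fixes m :: nat
  assumes h: "0 < h" and y: "0 < y" "y < d"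
  defines "R \<equiv> (real m + 1 / 2) * h"
  shows "norm (integral {- R..R} (\<lambda>x. de_integrand f (of_real x)) - de_sum f h {- int m..int m})
    \<le> discretization_bound h y + 3 * y * (majorant y R + majorant y (- R))"
proof -
  interpret rect: trapezoidal_rectangle "de_integrand f" d h y m
    using holomorphic_de_integrand[OF f_analytic] h y by unfold_locales
  have R: "rect.half_width = R" "0 \<le> R" using h by (auto simp: rect.half_width_def R_def)
  have sum_eq: "rect.trapezoidal_sum = de_sum f h {- int m..int m}"
    by (simp add: rect.trapezoidal_sum_def de_sum_def)
  have "norm (integral {- R..R} (\<lambda>x. de_integrand f (of_real x)) - de_sum f h {- int m..int m})
      \<le> 2 * integral {- R..R} (majorant y) / (exp (2 * pi * y / h) - 1)
        + 3 * y * (majorant y R + majorant y (- R))"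
    using rect.trapezoidal_error_le[of "majorant y"] y
      norm_de_integrand_le_majorant[of "Complex _ _" y]
      has_integral_integrable[OF has_integral_majorant[OF R(2)]] by (simp add: R(1) sum_eq)
  also have "\<dots> \<le> discretization_bound h y + 3 * y * (majorant y R + majorant y (- R))"
    unfolding discretization_bound_def using y h R(2) integral_majorant_le
    by (intro add_right_mono divide_right_mono mult_left_mono) auto
  finally show ?thesis .
qed

lemma truncation_error_le:
  assumes h: "0 < h" and M: "0 \<le> M" "M \<le> int m" and N: "0 \<le> N" "N \<le> int m"
    and tail_M: "\<And>l. de_tail (de_rate \<alpha> 0) h (real_of_int M * h) l \<le> \<tau>"
    and tail_N: "\<And>l. de_tail (de_rate \<beta> 0) h (real_of_int N * h) l \<le> \<tau>'"
  shows "norm (de_sum f h {- int m..int m} - de_sum f h {- M..N})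
    \<le> de_const K \<alpha> 0 * \<tau> + de_const K \<beta> 0 * \<tau>'"
proof -
  define G where "G = (\<lambda>k::int. de_integrand f (of_real (real_of_int k * h)))"
  have G: "norm (G k) \<le> majorant 0 (real_of_int k * h)" for k
    using norm_de_integrand_le_majorant[of "of_real (real_of_int k * h)" 0] d by (simp add: G_def)
  have sign: "0 < real_of_int k * h" if "0 < k" for k using that h by simp
  have "{- int m..int m} = {- M..N} \<union> ({- int m..<- M} \<union> {N<..int m})" using M N by auto
  then have "sum G {- int m..int m} = sum G {- M..N} + (sum G {- int m..<- M} + sum G {N<..int m})"
    using M N by (simp only:) (subst sum.union_disjoint, auto)+
  also have "sum G {- int m..<- M} = (\<Sum>k\<in>{M<..int m}. G (- k))"
    by (rule sum.reindex_bij_witness[of _ uminus uminus]) auto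
  finally have "de_sum f h {- int m..int m} - de_sum f h {- M..N}
      = of_real h * ((\<Sum>k\<in>{M<..int m}. G (- k)) + sum G {N<..int m})"
    by (simp add: de_sum_def G_def algebra_simps)
  then have "norm (de_sum f h {- int m..int m} - de_sum f h {- M..N})
      \<le> h * norm (\<Sum>k\<in>{M<..int m}. G (- k)) + h * norm (sum G {N<..int m})"
    using h norm_triangle_ineq[of "\<Sum>k\<in>{M<..int m}. G (- k)" "sum G {N<..int m}"]
    by (simp add: norm_mult flip: distrib_left)
  also have "\<dots> \<le> de_const K \<alpha> 0 * \<tau> + de_const K \<beta> 0 * \<tau>'"
  proof (intro add_mono norm_sum_int_tail_le[OF h _ _ tail_M] norm_sum_int_tail_le[OF h _ _ tail_N])
    show "norm (G (- k)) \<le> de_const K \<alpha> 0 * de_weight (de_rate \<alpha> 0) (real_of_int k * h)"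
      if "M < k" for k
      using G[of "- k"] sign[of k] that M by (simp add: majorant_def exponent_def)
    show "norm (G k) \<le> de_const K \<beta> 0 * de_weight (de_rate \<beta> 0) (real_of_int k * h)"
      if "N < k" for k
      using G[of k] sign[of k] that N by (simp add: majorant_def exponent_def)
  qed (use K \<alpha> \<beta> in \<open>auto intro!: de_const_nonneg\<close>)
  finally show ?thesis .
qed

lemma continuous_on_f_of_real: "continuous_on UNIV (\<lambda>t::real. f (of_real t))"
proof (rule continuous_at_imp_continuous_on, rule ballI)
  fix t :: real
  obtain x where "of_real t = psi (of_real x)" "complex_of_real x \<in> strip d"
    using of_real_in_psi_strip[OF d(1)] .
  then have "isCont f (of_real t)"
    using analytic_on_imp_differentiable_at[OF f_analytic]
    by (intro field_differentiable_imp_continuous_at) auto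
  then show "isCont (\<lambda>t::real. f (of_real t)) t"
    by (intro isCont_o2[where f = complex_of_real and g = f]) (auto intro: continuous_intros)
qed

lemma f_of_real_integrable: "(\<lambda>t::real. f (of_real t)) integrable_on UNIV"
proof (rule integrable_on_UNIV_polynomial_decay[OF continuous_on_f_of_real])
  show "0 < min \<alpha> \<beta>" "0 \<le> K" using \<alpha> \<beta> K by auto
  fix t :: real
  obtain x where x: "of_real t = psi (of_real x)" "complex_of_real x \<in> strip d"
    using of_real_in_psi_strip[OF d(1)] .
  have "norm (1 + (complex_of_real t)\<^sup>2) = norm (complex_of_real (1 + t\<^sup>2))" by simp
  also have "\<dots> = 1 + t\<^sup>2" by (simp only: norm_of_real) simp
  finally have "norm (f (of_real t)) \<le> K * (1 + t\<^sup>2) powr (- (exponent x + 1) / 2)"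
    using norm_f_psi_le[OF x(2)] x(1) by simp
  also have "\<dots> \<le> K * (1 + t\<^sup>2) powr (- (min \<alpha> \<beta> + 1) / 2)"
    using K by (intro mult_left_mono powr_mono) (auto simp: exponent_def)
  finally show "norm (f (of_real t)) \<le> K * (1 + t\<^sup>2) powr (- (min \<alpha> \<beta> + 1) / 2)" .
qed

lemma integral_de_integrand_tendsto:
  assumes "filterlim R at_top sequentially" "\<And>m. 0 \<le> R m"
  shows "(\<lambda>m. integral {- R m..R m} (\<lambda>x. de_integrand f (of_real x)))
    \<longlonglongrightarrow> integral UNIV (\<lambda>t. f (of_real t))"
  unfolding integral_de_integrand[OF continuous_on_f_of_real assms(2)]
  by (intro integral_symmetric_interval_tendsto f_of_real_integrable
      filterlim_compose[OF sinh_real_at_top]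
      filterlim_tendsto_pos_mult_at_top[OF tendsto_const] assms(1)) auto

context
  fixes h \<tau> \<tau>' :: real and M N :: int
  assumes h: "0 < h" and M: "0 \<le> M" and N: "0 \<le> N"
    and tail_M: "\<And>l. de_tail (de_rate \<alpha> 0) h (real_of_int M * h) l \<le> \<tau>"
    and tail_N: "\<And>l. de_tail (de_rate \<beta> 0) h (real_of_int N * h) l \<le> \<tau>'"
begin

lemma quadrature_error_le_interior:
  assumes y: "0 < y" "y < d"
  shows "quadrature_error h M N
    \<le> discretization_bound h y + (de_const K \<alpha> 0 * \<tau> + de_const K \<beta> 0 * \<tau>')"
    (is "_ \<le> _ + ?T")
proof -
  define R where "R = (\<lambda>m. (real m + 1 / 2) * h)"
  define I where "I = (\<lambda>m. integral {- R m..R m} (\<lambda>x. de_integrand f (of_real x)))"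
  define side where "side = (\<lambda>m. 3 * y * (majorant y (R m) + majorant y (- R m)))"
  have R: "filterlim R at_top sequentially" "0 \<le> R m" for m
    unfolding R_def using h by (real_asymp, simp)
  have "quadrature_error h M N \<le> discretization_bound h y + 0 + ?T"
  proof (rule LIMSEQ_le)
    show "(\<lambda>m. norm (I m - de_sum f h {- M..N})) \<longlonglongrightarrow> quadrature_error h M N"
      unfolding I_def using R by (intro tendsto_intros integral_de_integrand_tendsto) auto
    have "side \<longlonglongrightarrow> 3 * y * 0"
      unfolding side_def using y
      by (intro tendsto_intros filterlim_compose[OF majorant_tendsto_0 R(1)]) auto
    then show "(\<lambda>m. discretization_bound h y + side m + ?T) \<longlonglongrightarrow> discretization_bound h y + 0 + ?T"
      by (intro tendsto_intros) simp
    have "norm (I m - de_sum f h {- M..N}) \<le> discretization_bound h y + side m + ?T"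
      if "nat (max M N) \<le> m" for m
    proof -
      have "norm (I m - de_sum f h {- M..N}) \<le> norm (I m - de_sum f h {- int m..int m})
          + norm (de_sum f h {- int m..int m} - de_sum f h {- M..N})"
        by (metis dist_norm dist_triangle)
      also have "\<dots> \<le> discretization_bound h y + side m + ?T"
        unfolding I_def R_def side_def using that h y M N tail_M tail_N
        by (intro add_mono discretization_error_le truncation_error_le) auto
      finally show ?thesis .
    qed
    then show "\<exists>n0. \<forall>m\<ge>n0. norm (I m - de_sum f h {- M..N})
        \<le> discretization_bound h y + side m + ?T"
      by blast
  qed
  then show ?thesis by simp
qed

lemma quadrature_error_le:
  "quadrature_error h M N
    \<le> discretization_bound h d + (de_const K \<alpha> 0 * \<tau> + de_const K \<beta> 0 * \<tau>')"
    (is "_ \<le> _ + ?T")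
proof (rule tendsto_lowerbound)
  have "cos d \<noteq> 0" "cos (pi / 2 * sin d) \<noteq> 0"
    using d cos_gt_zero_pi[of d] cos_half_pi_sin_pos[of d] by auto
  then have "(de_const K \<gamma> \<longlongrightarrow> de_const K \<gamma> d) (at_left d)" if "0 < \<gamma>" for \<gamma>
    unfolding de_const_def[abs_def] using that by (intro tendsto_intros) auto
  then show "((\<lambda>y. discretization_bound h y + ?T) \<longlongrightarrow> discretization_bound h d + ?T) (at_left d)"
    unfolding discretization_bound_def using h d \<alpha> \<beta> by (intro tendsto_intros) auto
  show "\<forall>\<^sub>F y in at_left d. quadrature_error h M N \<le> discretization_bound h y + ?T"
    using eventually_at_left_real[OF d(1)]
    by eventually_elim (rule quadrature_error_le_interior; simp)
qed simp

end

lemma quadrature_error_le_uniform: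
  fixes M N :: int
  assumes h: "0 < h" and MN: "0 \<le> M" "0 \<le> N"
    and \<mu>: "0 < \<mu>" "\<mu> \<le> \<alpha>" "\<mu> \<le> \<beta>" and \<nu>: "\<alpha> \<le> \<nu>" "\<beta> \<le> \<nu>"
    and tails: "\<And>l. de_tail (de_rate \<alpha> 0) h (real_of_int M * h) l \<le> \<tau>"
      "\<And>l. de_tail (de_rate \<beta> 0) h (real_of_int N * h) l \<le> \<tau>"
  shows "quadrature_error h M N \<le> 2 powr (\<nu> + 1) * K / \<mu> *
    (2 / (cos (pi / 2 * sin d) powr \<nu> * cos d) * (1 / (exp (2 * pi * d / h) - 1)) + \<tau>)"
proof -
  define C where "C = (\<lambda>y. K * 2 powr \<nu> / (\<mu> * cos y * cos (pi / 2 * sin y) powr \<nu>))"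
  define E where "E = exp (2 * pi * d / h) - 1"
  have "0 < E" using h d by (simp add: E_def)
  have const_le: "de_const K \<gamma> y \<le> C y" if "\<gamma> = \<alpha> \<or> \<gamma> = \<beta>" "y = 0 \<or> y = d" for \<gamma> y
    unfolding C_def using that K \<mu> \<nu> d by (intro de_const_mono) auto
  have "0 \<le> \<tau>"
    using tails(1)[of 0] by (simp add: de_tail_def)
  have "quadrature_error h M N \<le> 2 * (de_const K \<alpha> d + de_const K \<beta> d) / E
      + (de_const K \<alpha> 0 * \<tau> + de_const K \<beta> 0 * \<tau>)"
    using quadrature_error_le[OF h MN tails] by (simp only: discretization_bound_def E_def)
  also have "\<dots> \<le> 2 * (C d + C d) / E + (C 0 * \<tau> + C 0 * \<tau>)"
    using const_le \<open>0 \<le> \<tau>\<close> \<open>0 < E\<close>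
    by (intro add_mono divide_right_mono mult_left_mono mult_right_mono) auto
  also have "\<dots> = 2 powr (\<nu> + 1) * K / \<mu> *
      (2 / (cos (pi / 2 * sin d) powr \<nu> * cos d) * (1 / E) + \<tau>)"
    by (simp add: C_def powr_add distrib_left mult_ac)
  finally show ?thesis by (simp only: E_def)
qed

end

section \<open>The choice of parameters\<close>

lemma exp_divide_self_mono:
  fixes u x :: real
  assumes "1 \<le> u" "u \<le> x"
  shows "exp u / u \<le> exp x / x"
proof -
  have "0 \<le> (x - u) * (u - 1)" using assms by simp
  then have "x \<le> (1 + (x - u)) * u" by (simp add: algebra_simps)
  also have "\<dots> \<le> exp (x - u) * u" using assms by (intro mult_right_mono) auto
  finally have "exp u * x \<le> exp u * (exp (x - u) * u)" by (intro mult_left_mono) auto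
  also have "\<dots> = exp x * u" by (simp add: exp_diff)
  finally show ?thesis using assms by (simp add: field_simps)
qed

lemma inverse_exp_minus_1_le:
  fixes x y :: real
  assumes "0 < y" "y \<le> x"
  shows "1 / (exp x - 1) \<le> exp (- x) / (1 - exp (- y))"
proof -
  have "1 / (exp x - 1) = exp (- x) / (1 - exp (- x))"
    using assms by (simp add: exp_minus field_simps)
  also have "\<dots> \<le> exp (- x) / (1 - exp (- y))"
    using assms by (intro divide_left_mono mult_pos_pos) auto
  finally show ?thesis .
qed

lemma one_le_ln_divide:
  fixes t \<gamma> \<nu> :: real
  assumes "0 < \<gamma>" "\<gamma> \<le> \<nu>" "\<nu> * exp 1 \<le> t"
  shows "1 \<le> ln (t / \<gamma>)"
proof -
  have "\<gamma> * exp 1 \<le> \<nu> * exp 1" using assms(2) by (intro mult_right_mono) auto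
  also have "\<dots> \<le> t" by (rule assms(3))
  finally have "exp 1 \<le> t / \<gamma>" using assms by (simp add: field_simps)
  then show ?thesis using less_le_trans[OF exp_gt_zero[of 1], of "t / \<gamma>"] by (simp add: ln_ge_iff)
qed

lemma inverse_exp_minus_1_le_ratio:
  assumes "0 < \<mu>" "0 < t" "1 \<le> ln (t / \<mu>)"
  shows "1 / (exp (pi * t / (4 * ln (t / \<mu>))) - 1)
    \<le> exp (- (pi * t / (4 * ln (t / \<mu>)))) / (1 - exp (- (pi * \<mu> * exp 1 / 4)))"
proof (rule inverse_exp_minus_1_le)
  have "exp 1 / 1 \<le> exp (ln (t / \<mu>)) / ln (t / \<mu>)" using assms by (intro exp_divide_self_mono) auto
  then have "pi * \<mu> / 4 * exp 1 \<le> pi * \<mu> / 4 * (t / \<mu> / ln (t / \<mu>))"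
    using assms by (intro mult_left_mono) auto
  then show "pi * \<mu> * exp 1 / 4 \<le> pi * t / (4 * ln (t / \<mu>))" using assms by simp
qed (use assms in simp)

lemma de_tail_le_exp_ratio:
  assumes \<gamma>: "0 < \<mu>" "\<mu> \<le> \<gamma>" "\<gamma> \<le> \<nu>" and "0 < h" and t: "\<nu> * exp 1 \<le> t"
    and x: "ln (t / \<gamma>) \<le> x" and xg: "xg (\<gamma> / 2) \<le> x"
  shows "de_tail (de_rate \<gamma> 0) h x l \<le> exp (pi * \<nu> / 4) * exp (- (pi * t / (4 * ln (t / \<mu>))))"
proof -
  have "0 < \<gamma>" using \<gamma> by simp
  have "0 < t" using \<gamma> by (intro less_le_trans[OF _ t] mult_pos_pos) auto
  have u: "1 \<le> ln (t / \<gamma>)" using one_le_ln_divide[OF \<open>0 < \<gamma>\<close> \<gamma>(3) t] .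
  have ln_le: "ln (t / \<gamma>) \<le> ln (t / \<mu>)"
    using \<gamma> \<open>0 < t\<close> by (intro ln_mono divide_left_mono divide_pos_pos mult_pos_pos) auto
  have "0 < ln (t / \<gamma>)" "0 < ln (t / \<mu>)" using u ln_le by linarith+
  then have "t / \<gamma> / ln (t / \<mu>) \<le> t / \<gamma> / ln (t / \<gamma>)"
    using ln_le \<open>0 < \<gamma>\<close> \<open>0 < t\<close> by (intro divide_left_mono mult_pos_pos) auto
  also have "\<dots> \<le> exp x / x" using exp_divide_self_mono[OF u x] \<open>0 < \<gamma>\<close> \<open>0 < t\<close> by simp
  finally have "pi * \<gamma> / 4 * (t / \<gamma> / ln (t / \<mu>)) \<le> pi * \<gamma> / 4 * (exp x / x)"
    using \<open>0 < \<gamma>\<close> by (intro mult_left_mono) auto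
  moreover have "pi * \<gamma> / 4 \<le> pi * \<nu> / 4" using \<gamma> by simp
  moreover have "pi * \<gamma> / 4 * (t / \<gamma> / ln (t / \<mu>)) = pi * t / (4 * ln (t / \<mu>))"
    using \<open>0 < \<gamma>\<close> by simp
  moreover have "de_rate \<gamma> 0 / 2 * (1 - exp x / x) = pi * \<gamma> / 4 - pi * \<gamma> / 4 * (exp x / x)"
    by (simp add: de_rate_def right_diff_distrib mult_ac)
  ultimately have exponent_le: "de_rate \<gamma> 0 / 2 * (1 - exp x / x)
      \<le> pi * \<nu> / 4 + - (pi * t / (4 * ln (t / \<mu>)))"
    by linarith
  have "de_tail (de_rate \<gamma> 0) h x l \<le> exp (de_rate \<gamma> 0 / 2 * (1 - exp x / x))"
    using \<open>0 < \<gamma>\<close> \<open>0 < h\<close> u x xg by (intro de_tail_le_exp_exp) (auto simp: de_rate_def)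
  also have "\<dots> \<le> exp (pi * \<nu> / 4) * exp (- (pi * t / (4 * ln (t / \<mu>))))"
    unfolding exp_add[symmetric] exp_le_cancel_iff by (rule exponent_le)
  finally show ?thesis .
qed

lemma ln_le_shifted_grid_point:
  fixes n :: nat
  assumes "0 < \<gamma>" "0 < \<mu>" "0 < t" "0 < h" and nh: "real n * h = ln (t / \<mu>)"
  shows "ln (t / \<gamma>) \<le> real_of_int (int n - \<lfloor>ln (\<gamma> / \<mu>) / h\<rfloor>) * h"
proof -
  have "real_of_int \<lfloor>ln (\<gamma> / \<mu>) / h\<rfloor> * h \<le> ln (\<gamma> / \<mu>) / h * h"
    using assms by (intro mult_right_mono) auto
  moreover have "ln (t / \<gamma>) = ln (t / \<mu>) - ln (\<gamma> / \<mu>)" using assms by (simp add: ln_div)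
  ultimately show ?thesis using nh \<open>0 < h\<close> by (simp add: algebra_simps)
qed

lemma (in de_function) quadrature_error_le_exp:
  fixes M N :: int
  assumes h: "0 < h" "h * t = 8 * d * ln (t / \<mu>)" and t: "\<nu> * exp 1 \<le> t"
    and \<mu>: "0 < \<mu>" "\<mu> \<le> \<alpha>" "\<mu> \<le> \<beta>" and \<nu>: "\<alpha> \<le> \<nu>" "\<beta> \<le> \<nu>"
    and M: "ln (t / \<alpha>) \<le> real_of_int M * h" "xg (\<alpha> / 2) \<le> real_of_int M * h"
    and N: "ln (t / \<beta>) \<le> real_of_int N * h" "xg (\<beta> / 2) \<le> real_of_int N * h"
  shows "quadrature_error h M N \<le> 2 powr (\<nu> + 1) * K / \<mu> *
    (2 / ((1 - exp (- pi * \<mu> * exp 1 / 4)) * cos (pi / 2 * sin d) powr \<nu> * cos d)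
     + exp (pi * \<nu> / 4)) * exp (- (2 * pi * d / h))"
proof -
  define c where "c = 2 / (cos (pi / 2 * sin d) powr \<nu> * cos d)"
  define Q where "Q = exp (- (2 * pi * d / h))"
  have c: "0 \<le> c" unfolding c_def using d by (simp add: cos_ge_zero)
  have "0 < \<nu>" using \<alpha> \<nu> by simp
  then have "0 < t" by (intro less_le_trans[OF _ t] mult_pos_pos) auto
  have ln_ge_1: "1 \<le> ln (t / \<mu>)" "1 \<le> ln (t / \<alpha>)" "1 \<le> ln (t / \<beta>)"
    using \<mu> \<nu> \<alpha> \<beta> by (auto intro!: one_le_ln_divide[OF _ _ t])
  have ratio: "pi * t / (4 * ln (t / \<mu>)) = 2 * pi * d / h"
    using h ln_ge_1(1) by (simp add: field_simps)
  have "0 < real_of_int M * h" "0 < real_of_int N * h" using M N ln_ge_1 by linarith+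
  then have nonneg: "0 \<le> M" "0 \<le> N" using h(1) by (simp_all add: zero_less_mult_iff)
  have tail: "de_tail (de_rate \<gamma> 0) h x l \<le> exp (pi * \<nu> / 4) * Q"
    if "\<mu> \<le> \<gamma>" "\<gamma> \<le> \<nu>" "ln (t / \<gamma>) \<le> x" "xg (\<gamma> / 2) \<le> x" for \<gamma> x l
    using de_tail_le_exp_ratio[OF \<mu>(1) that(1,2) h(1) t that(3,4)] by (simp only: ratio Q_def)
  have "quadrature_error h M N \<le> 2 powr (\<nu> + 1) * K / \<mu> *
      (c * (1 / (exp (2 * pi * d / h) - 1)) + exp (pi * \<nu> / 4) * Q)"
    unfolding c_def by (intro quadrature_error_le_uniform h nonneg \<mu> \<nu> tail M N)
  also have "\<dots> \<le> 2 powr (\<nu> + 1) * K / \<mu> *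
      (c * (Q / (1 - exp (- (pi * \<mu> * exp 1 / 4)))) + exp (pi * \<nu> / 4) * Q)"
    using inverse_exp_minus_1_le_ratio[OF \<mu>(1) \<open>0 < t\<close> ln_ge_1(1)] K \<mu>(1) c
    by (intro mult_left_mono add_right_mono) (auto simp: ratio Q_def)
  also have "\<dots> = 2 powr (\<nu> + 1) * K / \<mu> *
      (2 / ((1 - exp (- pi * \<mu> * exp 1 / 4)) * cos (pi / 2 * sin d) powr \<nu> * cos d)
       + exp (pi * \<nu> / 4)) * Q"
    by (simp add: c_def distrib_left distrib_right mult_ac)
  finally show ?thesis by (simp only: Q_def)
qed

theorem theorem7:
  fixes f :: "complex \<Rightarrow> complex"
    and d K \<alpha> \<beta> \<mu> \<nu> h C1 :: real and n :: nat and M N :: int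
  assumes d_pos: "0 < d" and d_lt: "d < pi/2"
    and f_an: "f analytic_on (psi ` strip d)"
    and K_pos: "K > 0" and \<alpha>_pos: "\<alpha> > 0" and \<beta>_pos: "\<beta> > 0"
    and bound_minus: "\<And>z. z \<in> psi ` strip_minus d \<Longrightarrow>
        norm (f z) \<le> K * norm (1 + z^2) powr (-(\<alpha> + 1)/2)"
    and bound_plus: "\<And>z. z \<in> psi ` strip_plus d \<Longrightarrow>
        norm (f z) \<le> K * norm (1 + z^2) powr (-(\<beta> + 1)/2)"
    and n_pos: "n > 0"
  assumes mu_def: "\<mu> = min \<alpha> \<beta>"
    and nu_def: "\<nu> = max \<alpha> \<beta>"
    and h_def: "h = ln (8 * d * real n / \<mu>) / real n"
  assumes M_def: "M = (if \<mu> = \<alpha> then int n else int n - \<lfloor>ln (\<alpha> / \<beta>) / h\<rfloor>)"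
    and N_def: "N = (if \<mu> = \<alpha> then int n - \<lfloor>ln (\<beta> / \<alpha>) / h\<rfloor> else int n)"
  assumes C1_def: "C1 = 2 powr (\<nu> + 1) * K / \<mu> *
      (2 / ((1 - exp (- pi * \<mu> * exp 1 / 4)) * (cos (pi / 2 * sin d)) powr \<nu> * cos d)
       + exp (pi * \<nu> / 4))"
  assumes n_large: "real n \<ge> \<nu> * exp 1 / (8 * d)"
    and M_large: "real_of_int M * h \<ge> xg (\<alpha> / 2)"
    and N_large: "real_of_int N * h \<ge> xg (\<beta> / 2)"
  shows "norm (integral UNIV (\<lambda>t::real. f (complex_of_real t))
              - complex_of_real h * (\<Sum>k\<in>{-M..N}.
                   f (psi (complex_of_real (real_of_int k * h)))
                   * deriv psi (complex_of_real (real_of_int k * h))))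
         \<le> C1 * exp (- 2 * pi * d * real n / ln (8 * d * real n / \<mu>))"
proof -
  interpret de_function f d K \<alpha> \<beta>
    using d_pos d_lt f_an K_pos \<alpha>_pos \<beta>_pos bound_minus bound_plus by unfold_locales
  define t where "t = 8 * d * real n"
  have \<mu>: "0 < \<mu>" "\<mu> \<le> \<alpha>" "\<mu> \<le> \<beta>" and \<nu>: "\<mu> \<le> \<nu>" "\<alpha> \<le> \<nu>" "\<beta> \<le> \<nu>"
    using \<alpha>_pos \<beta>_pos by (auto simp: mu_def nu_def)
  have t: "0 < t" "\<nu> * exp 1 \<le> t" using n_pos n_large d_pos by (simp_all add: t_def field_simps)
  have nh: "real n * h = ln (t / \<mu>)" using n_pos by (simp add: h_def t_def)
  then have "0 < real n * h" using one_le_ln_divide[OF \<mu>(1) \<nu>(1) t(2)] by simp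
  then have h: "0 < h" by (simp add: zero_less_mult_iff)
  have ln_le_M: "ln (t / \<alpha>) \<le> real_of_int M * h"
    using ln_le_shifted_grid_point[OF \<alpha>_pos \<mu>(1) t(1) h nh] nh mu_def
    by (auto simp: M_def min_def split: if_splits)
  have ln_le_N: "ln (t / \<beta>) \<le> real_of_int N * h"
    using ln_le_shifted_grid_point[OF \<beta>_pos \<mu>(1) t(1) h nh] nh mu_def
    by (auto simp: N_def min_def split: if_splits)
  have "2 * pi * d / h = 2 * pi * d * real n / ln (8 * d * real n / \<mu>)" by (simp add: h_def)
  moreover have "h * t = 8 * d * ln (t / \<mu>)" unfolding nh[symmetric] by (simp add: t_def)
  ultimately show ?thesis
    using quadrature_error_le_exp[OF h _ t(2) \<mu> \<nu>(2,3) ln_le_M M_large ln_le_N N_large]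
    by (simp add: C1_def de_sum_def de_integrand_def)
qed

end
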